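(* Let $\rho,\omega\in (L^1\cap L^\infty)(\mathbb{R}^2,\mathbb{R})$ be probability densities with compact supports and let $(\omega_N)_{N\geq 1}$ be a sequence of probability densities in $(L^1\cap L^\infty)(\mathbb{R}^2,\mathbb{R})$ with compact supports such that $\sup_N\|\omega_N\|_{L^1\cap L^\infty}<+\infty$. For any $0<\gamma<1$ there exists a constant $B$ depending only on $\gamma$, $\|\omega\|_{L^1\cap L^\infty}$, $\|\rho\|_{L^1\cap L^\infty}$ and $\sup_N\|\omega_N\|_{L^1\cap L^\infty}$ such that for every $N\ge 1$, every $v\in W^{1,\infty}(\mathbb{R}^2,\mathbb{R}^2)$, every $P_N=(p_1,\dots,p_N)\in(\mathbb{R}^2)^N$ and every $Q_N=(q_1,\dots,q_N)\in(\mathbb{R}^2)^N$ with $q_i\neq q_j$ for $i\neq j$, $$\iint_{(\mathbb{R}^2\times\mathbb{R}^2)\setminus\Delta} g(x-y)\,(\rho+\omega-\rho_N-\omega_N)^{\otimes 2}(\mathrm{d}x\,\mathrm{d}y)+BN^{-\gamma}\geq 0$$ and $$\mathcal{H}(\omega,\rho,v,\omega_N,Q_N,P_N)\geq 0,$$ where $\mathcal{H}$ is defined with these values of $B$ and $\gamma$.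
   Context: $g(x):=-\frac{1}{2\pi}\ln|x|$ on $\mathbb{R}^2$; $\Delta:=\{(x,x): x\in\mathbb{R}^2\}$; for a (signed) measure $\nu$, $\nu^{\otimes2}:=\nu\otimes\nu$; densities are identified with the corresponding measures. $\rho_N:=\frac1N\sum_{i=1}^N\delta_{q_i}$. The functional $\mathcal{H}$ is $$\begin{aligned}\mathcal{H}(\omega,\rho,v,\omega_N,Q_N,P_N):=&\ \frac1N\sum_{i=1}^N|v(q_i)-p_i|^2+\iint_{(\mathbb{R}^2\times\mathbb{R}^2)\setminus\Delta}g(x-y)(\rho+\omega-\rho_N-\omega_N)^{\otimes2}(\mathrm{d}x\,\mathrm{d}y)\\&+\iint_{\mathbb{R}^2\times\mathbb{R}^2}g(x-y)(\omega-\omega_N)(x)(\omega-\omega_N)(y)\,\mathrm{d}x\,\mathrm{d}y+\|\omega-\omega_N\|_{L^2}^2+BN^{-\gamma}.\end{aligned}$$ *)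

theory Defs
  imports "HOL-Probability.Probability"
begin

type_synonym R2 = "real^2"

(* Functions stand for their a.e. classes; all notions below up to W1inf are insensitive to the
   choice of a Borel representative. *)

definition norm_L1 :: "(R2 \<Rightarrow> 'a::{banach, second_countable_topology}) \<Rightarrow> ennreal" where
  "norm_L1 f = (\<integral>\<^sup>+x. ennreal (norm (f x)) \<partial>lborel)"

definition norm_Linf :: "(R2 \<Rightarrow> 'a::{banach, second_countable_topology}) \<Rightarrow> ennreal" where
  "norm_Linf f = esssup lborel (\<lambda>x. ennreal (norm (f x)))"

definition norm_L1_Linf :: "(R2 \<Rightarrow> 'a::{banach, second_countable_topology}) \<Rightarrow> ennreal" where
  "norm_L1_Linf f = norm_L1 f + norm_Linf f"

definition norm_L2 :: "(R2 \<Rightarrow> real) \<Rightarrow> real" where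
  "norm_L2 f = sqrt (LINT x|lborel. (f x)\<^sup>2)"

definition L1_Linf :: "(R2 \<Rightarrow> real) set" where
  "L1_Linf = {f \<in> borel_measurable borel. norm_L1_Linf f < \<infinity>}"

definition Linf :: "(R2 \<Rightarrow> 'a::{banach, second_countable_topology}) set" where
  "Linf = {f \<in> borel_measurable borel. norm_Linf f < \<infinity>}"

definition probability_density :: "(R2 \<Rightarrow> real) \<Rightarrow> bool" where
  "probability_density f \<longleftrightarrow>
     (AE x in lborel. 0 \<le> f x) \<and> integrable lborel f \<and> (LINT x|lborel. f x) = 1"

(* The essential support is contained in a compact set. *)
definition compactly_supported :: "(R2 \<Rightarrow> real) \<Rightarrow> bool" where
  "compactly_supported f \<longleftrightarrow> (\<exists>K. compact K \<and> (AE x in lborel. x \<notin> K \<longrightarrow> f x = 0))"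

definition partial_deriv :: "2 \<Rightarrow> (R2 \<Rightarrow> real) \<Rightarrow> R2 \<Rightarrow> real" where
  "partial_deriv i f x = frechet_derivative f (at x) (axis i 1)"

primrec C_k :: "nat \<Rightarrow> (R2 \<Rightarrow> real) \<Rightarrow> bool" where
  "C_k 0 f \<longleftrightarrow> continuous_on UNIV f"
| "C_k (Suc k) f \<longleftrightarrow> (\<forall>x. f differentiable (at x)) \<and> (\<forall>i. C_k k (partial_deriv i f))"

definition test_functions :: "(R2 \<Rightarrow> real) set" where
  "test_functions = {\<phi>. (\<forall>k. C_k k \<phi>) \<and> compact (closure {x. \<phi> x \<noteq> 0})}"

definition weak_partial_deriv :: "2 \<Rightarrow> (R2 \<Rightarrow> R2) \<Rightarrow> (R2 \<Rightarrow> R2) \<Rightarrow> bool" where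
  "weak_partial_deriv i v w \<longleftrightarrow>
     (\<forall>\<phi>\<in>test_functions.
        (LINT x|lborel. partial_deriv i \<phi> x *\<^sub>R v x) = - (LINT x|lborel. \<phi> x *\<^sub>R w x))"

(* Since v is evaluated at points, an element of the Sobolev space is identified with its
   (unique) continuous representative. *)
definition W1inf :: "(R2 \<Rightarrow> R2) set" where
  "W1inf = {v. continuous_on UNIV v \<and> v \<in> Linf \<and> (\<forall>i. \<exists>w\<in>Linf. weak_partial_deriv i v w)}"

(* A finite signed measure on M is represented by its real-valued set function on sets M;
   positive_part and negative_part are its Jordan decomposition.  The coercion ennreal sends negative values to 0,
   which does not change the supremum as the empty set is among the B. *)

definition positive_part :: "'a measure \<Rightarrow> ('a set \<Rightarrow> real) \<Rightarrow> 'a measure" where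
  "positive_part M \<sigma> =
     measure_of (space M) (sets M) (\<lambda>A. SUP B\<in>{B \<in> sets M. B \<subseteq> A}. ennreal (\<sigma> B))"

definition negative_part :: "'a measure \<Rightarrow> ('a set \<Rightarrow> real) \<Rightarrow> 'a measure" where
  "negative_part M \<sigma> = positive_part M (\<lambda>A. - \<sigma> A)"

definition signed_set_integral ::
    "'a measure \<Rightarrow> ('a set \<Rightarrow> real) \<Rightarrow> 'a set \<Rightarrow> ('a \<Rightarrow> real) \<Rightarrow> real" where
  "signed_set_integral M \<sigma> S f =
     (LINT x:S|positive_part M \<sigma>. f x) - (LINT x:S|negative_part M \<sigma>. f x)"

definition signed_product ::
    "'a measure \<Rightarrow> ('a set \<Rightarrow> real) \<Rightarrow> 'b measure \<Rightarrow> ('b set \<Rightarrow> real) \<Rightarrow> ('a \<times> 'b) set \<Rightarrow> real" where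
  "signed_product M \<sigma> N \<tau> C =
     measure (positive_part M \<sigma> \<Otimes>\<^sub>M positive_part N \<tau>) C
   - measure (positive_part M \<sigma> \<Otimes>\<^sub>M negative_part N \<tau>) C
   - measure (negative_part M \<sigma> \<Otimes>\<^sub>M positive_part N \<tau>) C
   + measure (negative_part M \<sigma> \<Otimes>\<^sub>M negative_part N \<tau>) C"

definition of_density :: "(R2 \<Rightarrow> real) \<Rightarrow> R2 set \<Rightarrow> real" where
  "of_density f A = (LINT x:A|lborel. f x)"

definition dirac :: "R2 \<Rightarrow> R2 set \<Rightarrow> real" where
  "dirac a A = indicator A a"

definition empirical :: "nat \<Rightarrow> (nat \<Rightarrow> R2) \<Rightarrow> R2 set \<Rightarrow> real" where
  "empirical N Q A = (1 / real N) * (\<Sum>i=1..N. dirac (Q i) A)"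

(* g 0 = 0 by the convention ln 0 = 0; g is only integrated off the diagonal or against
   absolutely continuous measures. *)
definition g :: "R2 \<Rightarrow> real" where
  "g x = - (1 / (2 * pi)) * ln (norm x)"

definition diagonal :: "(R2 \<times> R2) set" where
  "diagonal = {(x, x) | x. True}"

definition modulated_energy ::
    "(R2 \<Rightarrow> real) \<Rightarrow> (R2 \<Rightarrow> real) \<Rightarrow> (R2 \<Rightarrow> real) \<Rightarrow> nat \<Rightarrow> (nat \<Rightarrow> R2) \<Rightarrow> real" where
  "modulated_energy \<omega> \<rho> \<omega>N N Q =
     (let \<sigma> = (\<lambda>A. of_density \<rho> A + of_density \<omega> A - empirical N Q A - of_density \<omega>N A)
      in signed_set_integral (borel \<Otimes>\<^sub>M borel) (signed_product borel \<sigma> borel \<sigma>)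
           (UNIV - diagonal) (\<lambda>(x, y). g (x - y)))"

(* Q and P are points indexed by 1..N; their values at other indices do not matter. *)
definition \<H> ::
    "real \<Rightarrow> real \<Rightarrow> (R2 \<Rightarrow> real) \<Rightarrow> (R2 \<Rightarrow> real) \<Rightarrow> (R2 \<Rightarrow> R2) \<Rightarrow> (R2 \<Rightarrow> real) \<Rightarrow>
     nat \<Rightarrow> (nat \<Rightarrow> R2) \<Rightarrow> (nat \<Rightarrow> R2) \<Rightarrow> real" where
  "\<H> B \<gamma> \<omega> \<rho> v \<omega>N N Q P =
     (1 / real N) * (\<Sum>i=1..N. (norm (v (Q i) - P i))\<^sup>2)
   + modulated_energy \<omega> \<rho> \<omega>N N Q
   + (LINT (x, y)|(lborel \<Otimes>\<^sub>M lborel). g (x - y) * (\<omega> x - \<omega>N x) * (\<omega> y - \<omega>N y))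
   + (norm_L2 (\<lambda>x. \<omega> x - \<omega>N x))\<^sup>2
   + B * real N powr (- \<gamma>)"

end

theory Submission
  imports Defs "HOL-Real_Asymp.Real_Asymp"
begin

text \<open>By Frullani's formula \<open>- 2 ln r = \<integral>\<^sub>0\<^sup>\<infinity> (exp (- t r\<^sup>2) - exp (- t)) / t dt\<close> the off-diagonal energy of a neutral
  charge is a multiple of \<open>\<integral>\<^sub>0\<^sup>\<infinity> \<Phi>(t) / t dt\<close>, where \<open>\<Phi>(t)\<close> is its off-diagonal energy for the kernel
  \<open>exp (- t r\<^sup>2) - exp (- t)\<close>. Gaussians are positive definite, and restoring the diagonal of \<open>N\<close> point charges
  \<open>-1/N\<close> costs \<open>(1 - exp (- t)) / N\<close>, so \<open>\<Phi>(t) \<ge> - (1 - exp (- t)) / N\<close>. On the other hand only the products of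
  charges of opposite sign are negative, one of which is the bounded density, so the \<open>\<pi> / t\<close> mass of the
  Gaussian gives \<open>\<Phi>(t) \<ge> - C / t\<close>. For large \<open>t\<close> the two bounds are interpolated, which yields the
  rate \<open>N\<^sup>-\<^sup>\<gamma>\<close>. Without point charges the same argument shows that the remaining double integral in
  the functional is nonnegative.\<close>

section \<open>Densities of signed measures\<close>

text \<open>Neither bound on \<Phi> suffices alone: after division by \<open>t\<close> the first
  leaves \<open>1 / (N * t)\<close>, which diverges at infinity, and the second is integrable there
  but carries no decay in \<open>N\<close>. Their weighted geometric mean is of order
  \<open>N powr (- \<gamma>) * t powr (\<gamma> - 2)\<close>, integrable on \<open>{1..}\<close>
  exactly because \<gamma> < 1. For small \<open>t\<close> the inequality
  \<open>1 - exp (- t) \<le> t\<close> cancels the division. Neutrality enters when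
  \<open>exp (- t)\<close> is integrated over the full product: only a diagonal correction survives.
  The formal obstacle is that the energy is defined by Jordan parts of a set function and of its
  product, while point masses are singular to Lebesgue measure. Relative to one sigma-finite measure
  that also charges the points, the total charge has a density \<open>s\<close>, its Jordan parts
  have densities \<open>max 0 s\<close> and \<open>max 0 (- s)\<close>, and the energy becomes an
  ordinary double integral, to which Fubini applies once \<open>ln\<close> is integrable against the
  absolute charges.\<close>

definition add_measure :: "'a measure \<Rightarrow> 'a measure \<Rightarrow> 'a measure" where
  "add_measure M N = measure_of (space M) (sets M) (\<lambda>A. emeasure M A + emeasure N A)"

lemma space_add_measure [simp]: "space (add_measure M N) = space M"
  and sets_add_measure [simp, measurable_cong]: "sets (add_measure M N) = sets M"
  by (simp_all add: add_measure_def)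

lemma emeasure_add_measure:
  assumes "sets N = sets M" "A \<in> sets M"
  shows "emeasure (add_measure M N) A = emeasure M A + emeasure N A"
  unfolding add_measure_def
proof (rule emeasure_measure_of_sigma)
  show "sigma_algebra (space M) (sets M)" ..
  show "positive (sets M) (\<lambda>A. emeasure M A + emeasure N A)"
    by (simp add: positive_def)
  show "countably_additive (sets M) (\<lambda>A. emeasure M A + emeasure N A)"
    using assms(1) by (intro countably_additiveI) (simp add: suminf_add[symmetric] suminf_emeasure image_subset_iff)
qed (fact assms)

lemma nn_integral_add_measure:
  assumes [measurable_cong]: "sets N = sets M" and "f \<in> borel_measurable M"
  shows "(\<integral>\<^sup>+x. f x \<partial>add_measure M N) = (\<integral>\<^sup>+x. f x \<partial>M) + (\<integral>\<^sup>+x. f x \<partial>N)"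
  using assms(2)
proof (induction rule: borel_measurable_induct)
  case (cong f g)
  moreover have "space N = space M" using assms(1) by (rule sets_eq_imp_space_eq)
  ultimately show ?case
    by (simp cong: nn_integral_cong_simp)
next
  case (set A)
  then show ?case using assms(1) by (simp add: emeasure_add_measure)
next
  case (mult u c)
  then show ?case by (simp add: nn_integral_cmult distrib_left)
next
  case (add u v)
  then show ?case by (simp add: nn_integral_add ac_simps)
next
  case (seq U)
  have *: "(\<integral>\<^sup>+x. (SUP i. U i x) \<partial>K) = (SUP i. \<integral>\<^sup>+x. U i x \<partial>K)" if "sets K = sets M" for K
    using seq that by (intro nn_integral_monotone_convergence_SUP) (auto cong: measurable_cong_sets)
  have inc: "incseq (\<lambda>i. \<integral>\<^sup>+x. U i x \<partial>K)" for K
    using \<open>incseq U\<close> by (auto simp: incseq_def le_fun_def intro!: nn_integral_mono)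
  have "(\<integral>\<^sup>+x. (SUP i. U i x) \<partial>add_measure M N) = (SUP i. (\<integral>\<^sup>+x. U i x \<partial>M) + (\<integral>\<^sup>+x. U i x \<partial>N))"
    by (simp only: * sets_add_measure seq)
  also have "\<dots> = (SUP i. \<integral>\<^sup>+x. U i x \<partial>M) + (SUP i. \<integral>\<^sup>+x. U i x \<partial>N)"
    by (intro ennreal_SUP_add inc)
  also have "\<dots> = (\<integral>\<^sup>+x. (SUP i. U i x) \<partial>M) + (\<integral>\<^sup>+x. (SUP i. U i x) \<partial>N)"
    by (simp only: * assms(1))
  finally show ?case
    by (simp add: \<open>f = (SUP i. U i)\<close> SUP_apply image_comp comp_def)
qed

text \<open>\<open>{x. 0 < s x}\<close> is a Hahn set: no \<open>B\<close> inside \<open>A\<close>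
  collects more than the integral of the positive part of \<open>s\<close> over \<open>A\<close>,
  and cutting \<open>A\<close> with that set attains it. \<open>L\<close> integrates;
  \<open>M\<close> only names the space and sigma-algebra on which the set function is read.\<close>

lemma positive_part_set_integral:
  assumes int: "integrable L s" and sets: "sets L = sets M"
  shows "positive_part M (\<lambda>A. LINT x:A|L. s x) = density L (\<lambda>x. ennreal (s x))"
proof -
  have space: "space L = space M" using sets by (rule sets_eq_imp_space_eq)
  have [measurable]: "s \<in> borel_measurable L" using int by simp
  have *: "(SUP B\<in>{B \<in> sets M. B \<subseteq> A}. ennreal (LINT x:B|L. s x)) = emeasure (density L (\<lambda>x. ennreal (s x))) A"
    if A: "A \<in> sets M" for A
  proof (rule antisym)
    show "(SUP B\<in>{B \<in> sets M. B \<subseteq> A}. ennreal (LINT x:B|L. s x)) \<le> emeasure (density L (\<lambda>x. ennreal (s x))) A"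
    proof (rule SUP_least)
      fix B assume B: "B \<in> {B \<in> sets M. B \<subseteq> A}"
      then have "integrable L (\<lambda>x. indicator B x *\<^sub>R s x)"
        using int sets by (intro integrable_mult_indicator) auto
      then have "ennreal (LINT x:B|L. s x) \<le> (\<integral>\<^sup>+x. ennreal (indicator B x *\<^sub>R s x) \<partial>L)"
        unfolding set_lebesgue_integral_def
      proof -
        assume i: "integrable L (\<lambda>x. indicator B x *\<^sub>R s x)"
        have "(LINT x|L. indicator B x *\<^sub>R s x) \<le> (LINT x|L. max 0 (indicator B x *\<^sub>R s x))"
          using i by (intro integral_mono) auto
        then have "ennreal (LINT x|L. indicator B x *\<^sub>R s x) \<le> ennreal (LINT x|L. max 0 (indicator B x *\<^sub>R s x))"
          by (rule ennreal_leI)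
        also have "\<dots> = (\<integral>\<^sup>+x. ennreal (max 0 (indicator B x *\<^sub>R s x)) \<partial>L)"
          using i by (intro nn_integral_eq_integral[symmetric]) auto
        finally show "ennreal (LINT x|L. indicator B x *\<^sub>R s x) \<le> (\<integral>\<^sup>+x. ennreal (indicator B x *\<^sub>R s x) \<partial>L)"
          by (simp add: ennreal_max_0)
      qed
      also have "\<dots> \<le> (\<integral>\<^sup>+x. ennreal (s x) * indicator A x \<partial>L)"
        using B by (intro nn_integral_mono) (auto simp: indicator_def)
      also have "\<dots> = emeasure (density L (\<lambda>x. ennreal (s x))) A"
        using A sets by (simp add: emeasure_density)
      finally show "ennreal (LINT x:B|L. s x) \<le> emeasure (density L (\<lambda>x. ennreal (s x))) A" .
    qed
  next
    define B where "B = A \<inter> {x \<in> space L. 0 < s x}"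
    have [measurable]: "A \<in> sets L" using A sets by simp
    have B: "B \<in> sets L" unfolding B_def by measurable
    have "emeasure (density L (\<lambda>x. ennreal (s x))) A = (\<integral>\<^sup>+x. ennreal (s x) * indicator A x \<partial>L)"
      using A sets by (simp add: emeasure_density)
    also have "\<dots> = (\<integral>\<^sup>+x. ennreal (indicator B x *\<^sub>R s x) \<partial>L)"
      by (intro nn_integral_cong) (auto simp: B_def indicator_def ennreal_neg not_less)
    also have "\<dots> = ennreal (LINT x:B|L. s x)"
      unfolding set_lebesgue_integral_def using int B
      by (intro nn_integral_eq_integral integrable_mult_indicator AE_I2) (auto simp: B_def indicator_def)
    also have "\<dots> \<le> (SUP B\<in>{B \<in> sets M. B \<subseteq> A}. ennreal (LINT x:B|L. s x))"
      using B sets by (intro SUP_upper) (auto simp: B_def)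
    finally show "emeasure (density L (\<lambda>x. ennreal (s x))) A \<le> (SUP B\<in>{B \<in> sets M. B \<subseteq> A}. ennreal (LINT x:B|L. s x))" .
  qed
  have "positive_part M (\<lambda>A. LINT x:A|L. s x) =
    measure_of (space M) (sets M) (emeasure (density L (\<lambda>x. ennreal (s x))))"
    unfolding positive_part_def
    by (rule measure_of_eq) (auto simp: sets.space_closed sets.sigma_sets_eq *)
  also have "\<dots> = density L (\<lambda>x. ennreal (s x))"
    using measure_of_of_measure[of "density L (\<lambda>x. ennreal (s x))"] by (simp add: sets space)
  finally show ?thesis .
qed

lemma negative_part_set_integral:
  assumes int: "integrable L s" and sets: "sets L = sets M"
  shows "negative_part M (\<lambda>A. LINT x:A|L. s x) = density L (\<lambda>x. ennreal (- s x))"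
  using positive_part_set_integral[of L "\<lambda>x. - s x" M] assms
  by (simp add: negative_part_def set_lebesgue_integral_def)

text \<open>The Jordan parts have densities \<open>max 0 (s x)\<close> and
  \<open>max 0 (- s x)\<close>, both at most \<open>\<bar>s x\<bar>\<close>, so integrability of the
  single product \<open>s x * f x\<close> on \<open>S\<close> makes both integrals genuine and lets
  them be subtracted.\<close>

lemma signed_set_integral_set_integral:
  fixes f :: "'a \<Rightarrow> real"
  assumes int: "integrable L s" and sets: "sets L = sets M"
    and S: "S \<in> sets M" and [measurable]: "f \<in> borel_measurable M"
    and intf: "integrable L (\<lambda>x. indicator S x * (s x * f x))"
  shows "signed_set_integral M (\<lambda>A. LINT x:A|L. s x) S f = (LINT x|L. indicator S x * (s x * f x))"
proof -
  have [measurable]: "s \<in> borel_measurable L" "f \<in> borel_measurable L" "S \<in> sets L"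
    using int S sets \<open>f \<in> borel_measurable M\<close> by (auto cong: measurable_cong_sets)
  have density: "(LINT x:S|density L (\<lambda>x. ennreal (h x)). f x) = (LINT x|L. max 0 (h x) * (indicator S x * f x))"
    if [measurable]: "h \<in> borel_measurable L" for h
  proof -
    \<comment> \<open>\<open>ennreal\<close> truncates negative values silently;
      \<open>integral_density\<close> wants the truncation explicit.\<close>
    have "density L (\<lambda>x. ennreal (h x)) = density L (\<lambda>x. ennreal (max 0 (h x)))"
      by (simp add: ennreal_max_0)
    then have "(LINT x:S|density L (\<lambda>x. ennreal (h x)). f x) = (LINT x:S|density L (\<lambda>x. ennreal (max 0 (h x))). f x)"
      by (rule arg_cong)
    also have "\<dots> = (LINT x|L. max 0 (h x) * (indicator S x * f x))"
      unfolding set_lebesgue_integral_def by (subst integral_density) auto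
    finally show ?thesis .
  qed
  have int_max: "integrable L (\<lambda>x. max 0 (h x) * (indicator S x * f x))"
    if [measurable]: "h \<in> borel_measurable L" and "\<And>x. \<bar>h x\<bar> = \<bar>s x\<bar>" for h
  proof (rule Bochner_Integration.integrable_bound[OF intf])
    have "\<bar>max 0 (h x)\<bar> \<le> \<bar>s x\<bar>" for x
      using that(2)[of x] by linarith
    then show "AE x in L. norm (max 0 (h x) * (indicator S x * f x)) \<le> norm (indicator S x * (s x * f x))"
      by (intro AE_I2) (auto simp: abs_mult indicator_def intro!: mult_right_mono)
  qed measurable
  have "(LINT x|L. max 0 (s x) * (indicator S x * f x)) - (LINT x|L. max 0 (- s x) * (indicator S x * f x))
      = (LINT x|L. max 0 (s x) * (indicator S x * f x) - max 0 (- s x) * (indicator S x * f x))"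
    by (intro Bochner_Integration.integral_diff[symmetric] int_max) auto
  also have "\<dots> = (LINT x|L. indicator S x * (s x * f x))"
    by (intro Bochner_Integration.integral_cong) (auto simp: max_def)
  finally show ?thesis
    by (simp add: signed_set_integral_def positive_part_set_integral[OF int sets]
        negative_part_set_integral[OF int sets] density)
qed

text \<open>Jordan parts read a set function only on measurable sets, and
  \<open>signed_product\<close> is identified with an integral only there.\<close>

lemma signed_set_integral_cong:
  assumes "\<And>A. A \<in> sets M \<Longrightarrow> \<sigma> A = \<tau> A"
  shows "signed_set_integral M \<sigma> S f = signed_set_integral M \<tau> S f"
proof -
  have "positive_part M \<sigma> = positive_part M \<tau>" "negative_part M \<sigma> = negative_part M \<tau>"
    using assms by (simp_all add: positive_part_def negative_part_def cong: SUP_cong_simp)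
  then show ?thesis by (simp add: signed_set_integral_def)
qed

lemma signed_product_cong:
  assumes "\<And>A. A \<in> sets M \<Longrightarrow> \<sigma> A = \<sigma>' A" "\<And>A. A \<in> sets N \<Longrightarrow> \<tau> A = \<tau>' A"
  shows "signed_product M \<sigma> N \<tau> = signed_product M \<sigma>' N \<tau>'"
proof -
  have "positive_part M \<sigma> = positive_part M \<sigma>'" "negative_part M \<sigma> = negative_part M \<sigma>'"
    "positive_part N \<tau> = positive_part N \<tau>'" "negative_part N \<tau> = negative_part N \<tau>'"
    using assms by (simp_all add: positive_part_def negative_part_def cong: SUP_cong_simp)
  then show ?thesis by (simp add: signed_product_def fun_eq_iff)
qed

section \<open>Products of signed measures with densities\<close>

lemma (in pair_sigma_finite) integrable_product_mult:
  fixes s t :: "_ \<Rightarrow> real"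
  assumes "integrable M1 s" "integrable M2 t"
  shows "integrable (M1 \<Otimes>\<^sub>M M2) (\<lambda>(x, y). s x * t y)"
proof (rule Fubini_integrable)
  show "(\<lambda>(x, y). s x * t y) \<in> borel_measurable (M1 \<Otimes>\<^sub>M M2)"
    using assms[THEN borel_measurable_integrable] by measurable
  show "integrable M1 (\<lambda>x. LINT y|M2. norm (case (x, y) of (x, y) \<Rightarrow> s x * t y))"
    using assms by (simp add: abs_mult)
  show "AE x in M1. integrable M2 (\<lambda>y. case (x, y) of (x, y) \<Rightarrow> s x * t y)"
    using assms by simp
qed

lemma (in pair_sigma_finite) integral_product_mult:
  fixes s t :: "_ \<Rightarrow> real"
  assumes "integrable M1 s" "integrable M2 t"
  shows "(LINT (x, y)|(M1 \<Otimes>\<^sub>M M2). s x * t y) = (LINT x|M1. s x) * (LINT y|M2. t y)"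
  using integral_fst[OF integrable_product_mult[OF assms]] assms by simp

text \<open>Each of the four products of Jordan parts has a product density; the signs in
  \<open>signed_product\<close> are those of expanding
  \<open>(max 0 s - max 0 (- s)) * (max 0 t - max 0 (- t))\<close>.\<close>

lemma (in pair_sigma_finite) signed_product_set_integral:
  assumes s: "integrable M1 s" and t: "integrable M2 t"
    and sets1: "sets M1 = sets M" and sets2: "sets M2 = sets N" and C: "C \<in> sets (M \<Otimes>\<^sub>M N)"
  shows "signed_product M (\<lambda>A. LINT x:A|M1. s x) N (\<lambda>A. LINT x:A|M2. t x) C
    = (LINT p:C|(M1 \<Otimes>\<^sub>M M2). s (fst p) * t (snd p))"
proof -
  have [measurable]: "s \<in> borel_measurable M1" "t \<in> borel_measurable M2" using s t by simp_all
  have [measurable]: "C \<in> sets (M1 \<Otimes>\<^sub>M M2)"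
    using C sets1 sets2 by (simp cong: sets_pair_measure_cong)
  have int: "integrable (M1 \<Otimes>\<^sub>M M2) (\<lambda>p. indicator C p * (max 0 (a (fst p)) * max 0 (b (snd p))))"
    if "integrable M1 a" "integrable M2 b" for a b :: "_ \<Rightarrow> real"
  proof -
    have "integrable (M1 \<Otimes>\<^sub>M M2) (\<lambda>(x, y). max 0 (a x) * max 0 (b y))"
      using that by (intro integrable_product_mult[of "\<lambda>x. max 0 (a x)" "\<lambda>y. max 0 (b y)"]) auto
    then show ?thesis
      using integrable_mult_indicator[OF \<open>C \<in> sets (M1 \<Otimes>\<^sub>M M2)\<close>, of "\<lambda>(x, y). max 0 (a x) * max 0 (b y)"]
      by (simp add: case_prod_beta')
  qed
  have part: "measure (density M1 (\<lambda>x. ennreal (a x)) \<Otimes>\<^sub>M density M2 (\<lambda>x. ennreal (b x))) C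
    = (LINT p|(M1 \<Otimes>\<^sub>M M2). indicator C p * (max 0 (a (fst p)) * max 0 (b (snd p))))"
    if a: "integrable M1 a" and b: "integrable M2 b" for a b
  proof -
    have [measurable]: "a \<in> borel_measurable M1" "b \<in> borel_measurable M2" using a b by simp_all
    have "(\<integral>\<^sup>+x. ennreal (b x) \<partial>M2) < \<infinity>"
      using b by (auto simp: real_integrable_def top.not_eq_extremum)
    then have "finite_measure (density M2 (\<lambda>x. ennreal (b x)))"
      by (intro finite_measureI) (simp add: emeasure_density cong: nn_integral_cong)
    then interpret D: finite_measure "density M2 (\<lambda>x. ennreal (b x))" .
    have "density M1 (\<lambda>x. ennreal (a x)) \<Otimes>\<^sub>M density M2 (\<lambda>x. ennreal (b x))
      = density (M1 \<Otimes>\<^sub>M M2) (\<lambda>(x, y). ennreal (a x) * ennreal (b y))"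
      by (intro pair_measure_density) (auto intro: M2.sigma_finite_measure_axioms D.sigma_finite_measure_axioms)
    then have "emeasure (density M1 (\<lambda>x. ennreal (a x)) \<Otimes>\<^sub>M density M2 (\<lambda>x. ennreal (b x))) C
      = (\<integral>\<^sup>+p. ennreal (a (fst p)) * ennreal (b (snd p)) * indicator C p \<partial>(M1 \<Otimes>\<^sub>M M2))"
      by (simp add: emeasure_density case_prod_beta')
    also have "\<dots> = (\<integral>\<^sup>+p. ennreal (indicator C p * (max 0 (a (fst p)) * max 0 (b (snd p)))) \<partial>(M1 \<Otimes>\<^sub>M M2))"
      by (intro nn_integral_cong) (auto simp: ennreal_mult ennreal_max_0 indicator_def)
    \<comment> \<open>Finiteness matters: \<open>measure\<close> would return 0 on an infinite
      value.\<close>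
    also have "\<dots> = ennreal (LINT p|(M1 \<Otimes>\<^sub>M M2). indicator C p * (max 0 (a (fst p)) * max 0 (b (snd p))))"
      using int[OF a b] by (rule nn_integral_eq_integral) simp
    finally show ?thesis
      by (simp add: measure_def)
  qed
  let ?I = "\<lambda>a b. LINT p|(M1 \<Otimes>\<^sub>M M2). indicator C p * (max 0 (a (fst p)) * max 0 (b (snd p)))"
  have ms: "integrable M1 (\<lambda>x. - s x)" and mt: "integrable M2 (\<lambda>x. - t x)" using s t by auto
  note ints = int[OF s t] int[OF s mt] int[OF ms t] int[OF ms mt]
  have "signed_product M (\<lambda>A. LINT x:A|M1. s x) N (\<lambda>A. LINT x:A|M2. t x) C
    = ?I s t - ?I s (\<lambda>x. - t x) - ?I (\<lambda>x. - s x) t + ?I (\<lambda>x. - s x) (\<lambda>x. - t x)"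
    using s t ms mt by (simp add: signed_product_def positive_part_set_integral negative_part_set_integral sets1 sets2 part)
  also have "\<dots> = (LINT p|(M1 \<Otimes>\<^sub>M M2). indicator C p * (max 0 (s (fst p)) * max 0 (t (snd p)))
      - indicator C p * (max 0 (s (fst p)) * max 0 (- t (snd p)))
      - indicator C p * (max 0 (- s (fst p)) * max 0 (t (snd p)))
      + indicator C p * (max 0 (- s (fst p)) * max 0 (- t (snd p))))"
    using ints by simp
  also have "\<dots> = (LINT p:C|(M1 \<Otimes>\<^sub>M M2). s (fst p) * t (snd p))"
    unfolding set_lebesgue_integral_def
    by (intro Bochner_Integration.integral_cong) (auto simp: indicator_def max_def)
  finally show ?thesis .
qed

text \<open>Bridge from the definition of the energy to an ordinary integral: the product of
  \<open>\<sigma>\<close> with itself has density \<open>s (fst p) * s (snd p)\<close> relative to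
  the product of \<open>L\<close> with itself, and the result for one measure is applied to that
  density.\<close>

lemma signed_set_integral_signed_product:
  fixes f :: "_ \<Rightarrow> real"
  assumes L: "sigma_finite_measure L" and s: "integrable L s" and sets: "sets L = sets M"
    and S: "S \<in> sets (M \<Otimes>\<^sub>M M)" and f: "f \<in> borel_measurable (M \<Otimes>\<^sub>M M)"
    and int: "integrable (L \<Otimes>\<^sub>M L) (\<lambda>p. indicator S p * (s (fst p) * s (snd p) * f p))"
    and \<sigma>: "\<And>A. A \<in> sets M \<Longrightarrow> \<sigma> A = (LINT x:A|L. s x)"
  shows "signed_set_integral (M \<Otimes>\<^sub>M M) (signed_product M \<sigma> M \<sigma>) S f
    = (LINT p|(L \<Otimes>\<^sub>M L). indicator S p * (s (fst p) * s (snd p) * f p))"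
proof -
  interpret pair_sigma_finite L L
    using L by (simp add: pair_sigma_finite_def)
  have "signed_set_integral (M \<Otimes>\<^sub>M M) (signed_product M \<sigma> M \<sigma>) S f
    = signed_set_integral (M \<Otimes>\<^sub>M M) (\<lambda>C. LINT p:C|(L \<Otimes>\<^sub>M L). s (fst p) * s (snd p)) S f"
    using \<sigma> s sets
    by (intro signed_set_integral_cong)
      (simp add: signed_product_set_integral cong: signed_product_cong)
  also have "\<dots> = (LINT p|(L \<Otimes>\<^sub>M L). indicator S p * (s (fst p) * s (snd p) * f p))"
    using sets S f int integrable_product_mult[OF s s]
    by (intro signed_set_integral_set_integral) (auto simp: case_prod_beta' cong: sets_pair_measure_cong)
  finally show ?thesis .
qed

section \<open>Gaussians and the logarithm\<close>

text \<open>The Gaussian factors over coordinates, each contributing \<open>sqrt (pi / c)\<close>;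
  two coordinates give \<open>pi / c\<close>, the source of the \<open>1 / t\<close> decay in the
  plane.\<close>

lemma nn_integral_gaussian_R2:
  assumes c: "0 < c"
  shows "(\<integral>\<^sup>+x. ennreal (exp (- c * (norm (x - m :: R2))\<^sup>2)) \<partial>lborel) = ennreal (pi / c)"
proof -
  have 1: "(\<integral>\<^sup>+t. ennreal (exp (- c * (t - a)\<^sup>2)) \<partial>lborel) = ennreal (sqrt (pi / c))" for a :: real
  proof -
    \<comment> \<open>With variance \<open>1 / (2 * c)\<close> the exponential is a multiple of
      \<open>normal_density\<close>.\<close>
    define \<sigma> where "\<sigma> = sqrt (1 / (2 * c))"
    have \<sigma>: "0 < \<sigma>" "\<sigma>\<^sup>2 = 1 / (2 * c)" using c by (simp_all add: \<sigma>_def)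
    have eq: "exp (- c * (t - a)\<^sup>2) = sqrt (pi / c) * normal_density a \<sigma> t" for t
      using c by (simp add: normal_density_def \<sigma>(2) real_sqrt_divide)
    have "(\<integral>\<^sup>+t. ennreal (exp (- c * (t - a)\<^sup>2)) \<partial>lborel) = ennreal (LINT t|lborel. exp (- c * (t - a)\<^sup>2))"
      unfolding eq using \<sigma> by (intro nn_integral_eq_integral integrable_mult_right integrable_normal_density AE_I2) (auto simp: c less_imp_le)
    also have "(LINT t|lborel. exp (- c * (t - a)\<^sup>2)) = sqrt (pi / c)"
      unfolding eq using \<sigma> by simp
    finally show ?thesis .
  qed
  have "(norm (x - m))\<^sup>2 = (\<Sum>b\<in>Basis. (x \<bullet> b - m \<bullet> b)\<^sup>2)" for x :: R2
    by (simp only: norm_eq_sqrt_inner euclidean_inner[of "x - m" "x - m"])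
      (simp add: sum_nonneg power2_eq_square inner_diff_left)
  then have "(\<integral>\<^sup>+x. ennreal (exp (- c * (norm (x - m :: R2))\<^sup>2)) \<partial>lborel)
      = (\<integral>\<^sup>+x. (\<Prod>b\<in>Basis. ennreal (exp (- c * (x \<bullet> b - m \<bullet> b)\<^sup>2))) \<partial>lborel)"
    by (simp add: prod_ennreal sum_distrib_left exp_sum sum_negf[symmetric])
  also have "\<dots> = (\<Prod>b\<in>(Basis::R2 set). ennreal (sqrt (pi / c)))"
    by (subst nn_integral_lborel_prod) (simp_all add: 1[simplified])
  also have "\<dots> = ennreal (pi / c)"
    using c by (simp add: ennreal_power)
  finally show ?thesis .
qed

text \<open>The integrand is the integral of \<open>exp (- u * t)\<close> over \<open>u\<close> in
  \<open>{a..b}\<close>; Tonelli leaves the integral of \<open>1 / u\<close>.\<close>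

lemma nn_integral_frullani:
  fixes a b :: real
  assumes a: "0 < a" and ab: "a \<le> b"
  shows "(\<integral>\<^sup>+t. ennreal (indicator {0<..} t * ((exp (- a * t) - exp (- b * t)) / t)) \<partial>lborel) = ennreal (ln b - ln a)"
proof -
  have inner: "(\<integral>\<^sup>+u. ennreal (exp (- u * t)) * indicator {a..b} u \<partial>lborel) = ennreal ((exp (- a * t) - exp (- b * t)) / t)"
    if "0 < t" for t
  proof -
    have "(\<integral>\<^sup>+u. ennreal (exp (- u * t)) * indicator {a..b} u \<partial>lborel) = ennreal (- exp (- b * t) / t - (- exp (- a * t) / t))"
      using that ab by (intro nn_integral_FTC_Icc) (auto intro!: derivative_eq_intros)
    then show ?thesis by (simp add: diff_divide_distrib)
  qed
  have outer: "(\<integral>\<^sup>+t. ennreal (exp (- u * t)) * indicator {0..} t \<partial>lborel) = ennreal (1 / u)" if "0 < u" for u :: real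
  proof -
    have "((\<lambda>t. - exp (- u * t) / u) \<longlongrightarrow> 0) at_top"
      using that by real_asymp
    then have "(\<integral>\<^sup>+t. ennreal (exp (- u * t)) * indicator {0..} t \<partial>lborel) = ennreal (0 - (- exp (- u * 0) / u))"
      using that by (intro nn_integral_FTC_atLeast) (auto intro!: derivative_eq_intros)
    then show ?thesis by simp
  qed
  have "(\<integral>\<^sup>+t. ennreal (indicator {0<..} t * ((exp (- a * t) - exp (- b * t)) / t)) \<partial>lborel)
      = (\<integral>\<^sup>+t. (\<integral>\<^sup>+u. indicator {0<..} t * (ennreal (exp (- u * t)) * indicator {a..b} u) \<partial>lborel) \<partial>lborel)"
  proof (rule nn_integral_cong)
    fix t :: real
    show "ennreal (indicator {0<..} t * ((exp (- a * t) - exp (- b * t)) / t))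
      = (\<integral>\<^sup>+u. indicator {0<..} t * (ennreal (exp (- u * t)) * indicator {a..b} u) \<partial>lborel)"
      by (cases "0 < t") (simp_all add: inner[simplified])
  qed
  also have "\<dots> = (\<integral>\<^sup>+u. (\<integral>\<^sup>+t. indicator {0<..} t * (ennreal (exp (- u * t)) * indicator {a..b} u) \<partial>lborel) \<partial>lborel)"
    by (intro lborel_pair.Fubini') measurable
  also have "\<dots> = (\<integral>\<^sup>+u. ennreal (1 / u) * indicator {a..b} u \<partial>lborel)"
  proof (rule nn_integral_cong)
    fix u :: real
    show "(\<integral>\<^sup>+t. indicator {0<..} t * (ennreal (exp (- u * t)) * indicator {a..b} u) \<partial>lborel) = ennreal (1 / u) * indicator {a..b} u"
    proof (cases "u \<in> {a..b}")
      case True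
      then have "0 < u" using a by auto
      \<comment> \<open>\<open>{0<..}\<close> and \<open>{0..}\<close> differ by a null set; the
        closed half-line suits the fundamental theorem.\<close>
      have "AE t in lborel. t \<noteq> (0::real)" by (rule AE_lborel_singleton)
      then have "(\<integral>\<^sup>+t. indicator {0<..} t * (ennreal (exp (- u * t)) * indicator {a..b} u) \<partial>lborel) =
        (\<integral>\<^sup>+t. ennreal (exp (- u * t)) * indicator {0..} t \<partial>lborel)"
        using True by (intro nn_integral_cong_AE) (auto elim!: eventually_mono simp: indicator_def)
      then show ?thesis using True outer[OF \<open>0 < u\<close>] by simp
    qed simp
  qed
  also have "\<dots> = ennreal (ln b - ln a)"
    using a ab by (intro nn_integral_FTC_Icc) (auto intro!: derivative_eq_intros simp: field_simps)
  finally show ?thesis .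
qed

text \<open>The integrand has one sign, that of \<open>b - a\<close>, so the absolute value passes
  through. This is the norm computation behind the later use of Fubini.\<close>

lemma nn_integral_abs_frullani:
  fixes a b :: real
  assumes "0 < a" "0 < b"
  shows "(\<integral>\<^sup>+t. ennreal (\<bar>indicator {0<..} t * ((exp (- a * t) - exp (- b * t)) / t)\<bar>) \<partial>lborel) = ennreal \<bar>ln b - ln a\<bar>"
proof (cases "a \<le> b")
  case True
  then have "\<bar>indicator {0<..} t * ((exp (- a * t) - exp (- b * t)) / t)\<bar> = indicator {0<..} t * ((exp (- a * t) - exp (- b * t)) / t)" for t
    by (auto simp: indicator_def)
  then show ?thesis
    using True assms nn_integral_frullani[of a b] by simp
next
  case False
  then have "\<bar>indicator {0<..} t * ((exp (- a * t) - exp (- b * t)) / t)\<bar> = indicator {0<..} t * ((exp (- b * t) - exp (- a * t)) / t)" for t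
  proof (cases "0 < t")
    case True
    with \<open>\<not> a \<le> b\<close> have "(exp (- a * t) - exp (- b * t)) / t \<le> 0"
      by (intro divide_nonpos_pos) auto
    moreover have "\<bar>indicator {0<..} t * ((exp (- a * t) - exp (- b * t)) / t)\<bar> = \<bar>(exp (- a * t) - exp (- b * t)) / t\<bar>"
      using True by simp
    ultimately show ?thesis using True
      by (simp only: abs_of_nonpos minus_divide_left minus_diff_eq) simp
  qed simp
  then show ?thesis
    using False assms nn_integral_frullani[of b a] by simp
qed

lemma has_bochner_integral_frullani:
  fixes a b :: real
  assumes "0 < a" "0 < b"
  shows "has_bochner_integral lborel (\<lambda>t. indicator {0<..} t * ((exp (- a * t) - exp (- b * t)) / t)) (ln b - ln a)"
proof -
  have *: "has_bochner_integral lborel (\<lambda>t. indicator {0<..} t * ((exp (- a * t) - exp (- b * t)) / t)) (ln b - ln a)"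
    if "0 < a" "a \<le> b" for a b :: real
    using that by (intro has_bochner_integral_nn_integral nn_integral_frullani) (auto simp: indicator_def)
  show ?thesis
  proof (cases "a \<le> b")
    case False
    then have "has_bochner_integral lborel (\<lambda>t. - (indicator {0<..} t * ((exp (- b * t) - exp (- a * t)) / t))) (- (ln a - ln b))"
      using assms by (intro has_bochner_integral_minus *) auto
    then show ?thesis
      by (simp add: diff_divide_distrib algebra_simps)
  qed (use * assms in auto)
qed

section \<open>Integrability of the logarithm against bounded densities\<close>

lemma nn_integral_inverse_square:
  "(\<integral>\<^sup>+t. ennreal (1 / t\<^sup>2) * indicator {1::real..} t \<partial>lborel) = 1"
proof -
  have "((\<lambda>t::real. - 1 / t) \<longlongrightarrow> 0) at_top" by real_asymp
  then have "(\<integral>\<^sup>+t. ennreal (1 / t\<^sup>2) * indicator {1::real..} t \<partial>lborel) = ennreal (0 - (- 1 / 1))"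
    by (intro nn_integral_FTC_atLeast) (auto intro!: derivative_eq_intros simp: field_simps power2_eq_square)
  then show ?thesis by simp
qed

text \<open>Near 0 the logarithm is traded for a superposition of Gaussians, whose integrals over
  the plane are known; \<open>r + 1\<close> absorbs the part \<open>t < 1\<close> of Frullani's
  integral and the growth for \<open>r > 1\<close>.\<close>

lemma abs_ln_le:
  fixes r :: real
  assumes r: "0 < r"
  shows "ennreal \<bar>ln r\<bar> \<le> ennreal (r + 1) + (\<integral>\<^sup>+t. indicator {1..} t * ennreal (exp (- t * r\<^sup>2) / t) \<partial>lborel)"
proof (cases "r \<le> 1")
  case True
  then have "r\<^sup>2 \<le> 1" using r by (simp add: power_le_one)
  \<comment> \<open>\<open>ln (r\<^sup>2)\<close> is twice \<open>ln r\<close>; the factor 2 is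
    given away.\<close>
  have "ennreal \<bar>ln r\<bar> \<le> ennreal (ln 1 - ln (r\<^sup>2))"
    using True r by (intro ennreal_leI) (simp add: ln_realpow ln_le_zero_iff)
  also have "\<dots> = (\<integral>\<^sup>+t. ennreal (indicator {0<..} t * ((exp (- r\<^sup>2 * t) - exp (- 1 * t)) / t)) \<partial>lborel)"
    using r \<open>r\<^sup>2 \<le> 1\<close> by (intro nn_integral_frullani[symmetric]) auto
  also have "\<dots> \<le> (\<integral>\<^sup>+t. indicator {0..1} t + indicator {1..} t * ennreal (exp (- t * r\<^sup>2) / t) \<partial>lborel)"
  proof (rule nn_integral_mono)
    fix t :: real
    consider "t \<le> 0" | "0 < t" "t < 1" | "1 \<le> t" by linarith
    then show "ennreal (indicator {0<..} t * ((exp (- r\<^sup>2 * t) - exp (- 1 * t)) / t))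
       \<le> indicator {0..1} t + indicator {1..} t * ennreal (exp (- t * r\<^sup>2) / t)"
    proof cases
      case 2
      have "exp (- r\<^sup>2 * t) - exp (- 1 * t) \<le> 1 - (1 + (- t))"
        using 2 exp_ge_add_one_self[of "- t"] by (intro diff_mono) auto
      then show ?thesis using 2 by (simp add: field_simps ennreal_le_1)
    next
      case 3
      then have "(exp (- r\<^sup>2 * t) - exp (- 1 * t)) / t \<le> exp (- t * r\<^sup>2) / t"
        by (intro divide_right_mono) (auto simp: mult.commute)
      then have "ennreal (indicator {0<..} t * ((exp (- r\<^sup>2 * t) - exp (- 1 * t)) / t)) \<le> ennreal (exp (- t * r\<^sup>2) / t)"
        using 3 by (intro ennreal_leI) simp
      also have "\<dots> = 0 + indicator {1..} t * ennreal (exp (- t * r\<^sup>2) / t)" using 3 by simp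
      also have "\<dots> \<le> indicator {0..1} t + indicator {1..} t * ennreal (exp (- t * r\<^sup>2) / t)"
        by (intro add_right_mono) simp
      finally show ?thesis .
    qed simp
  qed
  also have "\<dots> = 1 + (\<integral>\<^sup>+t. indicator {1..} t * ennreal (exp (- t * r\<^sup>2) / t) \<partial>lborel)"
    by (subst nn_integral_add) auto
  also have "\<dots> \<le> ennreal (r + 1) + (\<integral>\<^sup>+t. indicator {1..} t * ennreal (exp (- t * r\<^sup>2) / t) \<partial>lborel)"
    using r by (intro add_right_mono) (simp add: ennreal_leI flip: ennreal_1)
  finally show ?thesis .
next
  case False
  then have "\<bar>ln r\<bar> \<le> r + 1"
    using ln_le_minus_one[of r] by simp
  then have "ennreal \<bar>ln r\<bar> \<le> ennreal (r + 1) + 0"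
    by (simp only: ennreal_leI add_0_right)
  also have "\<dots> \<le> ennreal (r + 1) + (\<integral>\<^sup>+t. indicator {1..} t * ennreal (exp (- t * r\<^sup>2) / t) \<partial>lborel)"
    by (intro add_left_mono) simp
  finally show ?thesis .
qed

text \<open>Where \<open>f\<close> is nonzero the distance to \<open>y\<close> is at most
  \<open>R + norm y\<close>, which handles the term \<open>r + 1\<close> of
  \<open>abs_ln_le\<close>. In the Gaussian term \<open>f\<close> is replaced by its bound
  \<open>K\<close>: the Gaussian mass \<open>pi / t\<close>, divided by \<open>t\<close>, integrates
  to \<open>pi\<close> over \<open>{1..}\<close>.\<close>

lemma nn_integral_log_potential_le:
  fixes f :: "R2 \<Rightarrow> real"
  assumes f: "integrable lborel f" and K: "AE x in lborel. \<bar>f x\<bar> \<le> K"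
    and R: "AE x in lborel. f x \<noteq> 0 \<longrightarrow> norm x \<le> R"
    and nonneg: "0 \<le> K" "0 \<le> R"
  shows "(\<integral>\<^sup>+x. ennreal (\<bar>f x\<bar> * \<bar>ln (norm (x - y))\<bar>) \<partial>lborel)
    \<le> ennreal ((R + norm y + 1) * (LINT x|lborel. \<bar>f x\<bar>) + K * pi)"
proof -
  have [measurable]: "f \<in> borel_measurable borel" using f by simp
  let ?G = "\<lambda>x. \<integral>\<^sup>+t. indicator {1..} t * ennreal (exp (- t * (norm (x - y))\<^sup>2) / t) \<partial>lborel"
  have "(\<integral>\<^sup>+x. ennreal (\<bar>f x\<bar> * \<bar>ln (norm (x - y))\<bar>) \<partial>lborel)
    \<le> (\<integral>\<^sup>+x. ennreal (R + norm y + 1) * ennreal \<bar>f x\<bar> + ennreal K * ?G x \<partial>lborel)"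
  proof (rule nn_integral_mono_AE)
    have "AE x in lborel. x \<noteq> y" by (rule AE_lborel_singleton)
    with K R show "AE x in lborel. ennreal (\<bar>f x\<bar> * \<bar>ln (norm (x - y))\<bar>) \<le> ennreal (R + norm y + 1) * ennreal \<bar>f x\<bar> + ennreal K * ?G x"
    proof eventually_elim
      case (elim x)
      show ?case
      proof (cases "f x = 0")
        case False
        then have "norm (x - y) \<le> R + norm y" using elim norm_triangle_ineq4[of x y] by simp
        then have "ennreal \<bar>ln (norm (x - y))\<bar> \<le> ennreal (R + norm y + 1) + ?G x"
          using elim by (intro order_trans[OF abs_ln_le] add_right_mono ennreal_leI) auto
        then have "ennreal (\<bar>f x\<bar> * \<bar>ln (norm (x - y))\<bar>) \<le> ennreal \<bar>f x\<bar> * (ennreal (R + norm y + 1) + ?G x)"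
          by (simp add: ennreal_mult' mult_left_mono)
        also have "\<dots> \<le> ennreal (R + norm y + 1) * ennreal \<bar>f x\<bar> + ennreal K * ?G x"
          using elim by (simp add: distrib_left mult.commute add_mono mult_mono ennreal_leI)
        finally show ?thesis .
      qed simp
    qed
  qed
  also have "\<dots> = ennreal (R + norm y + 1) * ennreal (LINT x|lborel. \<bar>f x\<bar>) + ennreal K * (\<integral>\<^sup>+x. ?G x \<partial>lborel)"
    using f by (simp add: nn_integral_add nn_integral_cmult nn_integral_eq_integral)
  also have "(\<integral>\<^sup>+x. ?G x \<partial>lborel) = (\<integral>\<^sup>+t. (\<integral>\<^sup>+x. indicator {1..} t * ennreal (exp (- t * (norm (x - y))\<^sup>2) / t) \<partial>lborel) \<partial>lborel)"
    by (intro lborel_pair.Fubini') measurable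
  also have "\<dots> = (\<integral>\<^sup>+t. ennreal pi * (ennreal (1 / t\<^sup>2) * indicator {1..} t) \<partial>lborel)"
  proof (rule nn_integral_cong)
    fix t :: real
    show "(\<integral>\<^sup>+x. indicator {1..} t * ennreal (exp (- t * (norm (x - y))\<^sup>2) / t) \<partial>lborel) = ennreal pi * (ennreal (1 / t\<^sup>2) * indicator {1..} t)"
    proof (cases "1 \<le> t")
      case True
      then have "(\<integral>\<^sup>+x. indicator {1..} t * ennreal (exp (- t * (norm (x - y))\<^sup>2) / t) \<partial>lborel)
        = (\<integral>\<^sup>+x. ennreal (1 / t) * ennreal (exp (- t * (norm (x - y))\<^sup>2)) \<partial>lborel)"
        by (intro nn_integral_cong) (simp flip: ennreal_mult)
      also have "\<dots> = ennreal (1 / t) * ennreal (pi / t)"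
        using True nn_integral_gaussian_R2[of t y] by (subst nn_integral_cmult) auto
      also have "\<dots> = ennreal pi * ennreal (1 / t\<^sup>2)"
        using True by (simp add: power2_eq_square flip: ennreal_mult)
      finally show ?thesis using True by simp
    qed simp
  qed
  also have "\<dots> = ennreal pi"
    by (subst nn_integral_cmult) (auto simp: nn_integral_inverse_square)
  also have "ennreal (R + norm y + 1) * ennreal (LINT x|lborel. \<bar>f x\<bar>) + ennreal K * ennreal pi
    = ennreal ((R + norm y + 1) * (LINT x|lborel. \<bar>f x\<bar>) + K * pi)"
    using nonneg by (simp add: ennreal_mult ennreal_plus)
  finally show ?thesis .
qed

section \<open>The logarithmic energy of a neutral charge\<close>

abbreviation gaussian :: "real \<Rightarrow> R2 \<Rightarrow> R2 \<Rightarrow> real" where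
  "gaussian t x y \<equiv> exp (- t * (norm (x - y))\<^sup>2)"

text \<open>Parallelogram identity about the midpoint of \<open>x\<close> and \<open>y\<close>.
  Integrated over \<open>z\<close>, the last factor gives \<open>pi / (4 * t)\<close>, independent
  of \<open>x\<close> and \<open>y\<close>.\<close>

lemma gaussian_mult_gaussian:
  "gaussian (2 * t) x z * gaussian (2 * t) y z = gaussian t x y * gaussian (4 * t) z ((1 / 2) *\<^sub>R (x + y))"
proof -
  have "2 * ((norm (x - z))\<^sup>2 + (norm (y - z))\<^sup>2) = (norm (x - y))\<^sup>2 + 4 * (norm (z - (1 / 2) *\<^sub>R (x + y)))\<^sup>2"
    by (simp add: power2_norm_eq_inner inner_diff_left inner_diff_right inner_add_left inner_add_right inner_commute field_simps)
  then have "t * (2 * ((norm (x - z))\<^sup>2 + (norm (y - z))\<^sup>2)) = t * ((norm (x - y))\<^sup>2 + 4 * (norm (z - (1 / 2) *\<^sub>R (x + y)))\<^sup>2)"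
    by simp
  then show ?thesis
    by (simp add: mult_exp_exp algebra_simps)
qed

lemma has_bochner_integral_gaussian:
  "0 < t \<Longrightarrow> has_bochner_integral lborel (\<lambda>x. gaussian t x m) (pi / t)"
  by (intro has_bochner_integral_nn_integral nn_integral_gaussian_R2) auto

lemma diagonal_eq: "diagonal = {p. fst p = snd p}"
  by (auto simp: diagonal_def)

lemma sets_diagonal [measurable]: "diagonal \<in> sets (borel \<Otimes>\<^sub>M borel)"
proof -
  have "closed {p :: R2 \<times> R2. fst p = snd p}"
    by (intro closed_Collect_eq continuous_intros)
  then show ?thesis
    unfolding diagonal_eq borel_prod by (rule borel_closed)
qed

lemma integrable_bounded_mult:
  fixes h k :: "_ \<Rightarrow> real"
  assumes "integrable M h" and [measurable]: "k \<in> borel_measurable M" and "\<And>x. \<bar>k x\<bar> \<le> 1"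
  shows "integrable M (\<lambda>x. k x * h x)"
proof (rule Bochner_Integration.integrable_bound[OF assms(1)])
  show "(\<lambda>x. k x * h x) \<in> borel_measurable M" using assms(1) by measurable
  show "AE x in M. norm (k x * h x) \<le> norm (h x)"
    using assms(3) by (intro AE_I2) (simp add: abs_mult mult_left_le_one_le)
qed

text \<open>\<open>L\<close> may have atoms, so \<open>diagonal\<close> can carry mass. Since
  \<open>ln 0 = 0\<close>, the integrand in \<open>integrable_log\<close> vanishes there and the
  condition concerns only distinct points.\<close>

locale neutral_charge = sigma_finite_measure L for L :: "R2 measure" +
  fixes s :: "R2 \<Rightarrow> real"
  assumes sets_L [measurable_cong]: "sets L = sets borel"
    and integrable_charge: "integrable L s"
    and neutral: "(LINT x|L. s x) = 0"
    and integrable_log: "integrable (L \<Otimes>\<^sub>M L) (\<lambda>p. s (fst p) * s (snd p) * ln (norm (fst p - snd p)))"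
begin

sublocale pair_sigma_finite L L ..

lemma measurable_charge [measurable]: "s \<in> borel_measurable borel"
  using borel_measurable_integrable[OF integrable_charge] by (simp cong: measurable_cong_sets add: sets_L)

lemma sets_diagonal_L [measurable]: "diagonal \<in> sets (L \<Otimes>\<^sub>M L)"
  using sets_diagonal by (simp cong: sets_pair_measure_cong add: sets_L)

lemma integrable_pair_charge: "integrable (L \<Otimes>\<^sub>M L) (\<lambda>p. s (fst p) * s (snd p))"
  using integrable_product_mult[OF integrable_charge integrable_charge] by (simp add: case_prod_beta')

lemma integral_pair_charge: "(LINT p|(L \<Otimes>\<^sub>M L). s (fst p) * s (snd p)) = 0"
  using integral_product_mult[OF integrable_charge integrable_charge] neutral by (simp add: case_prod_beta')

text \<open>Up to a factor, the Gaussian kernel is the convolution square of a Gaussian, so its energy is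
  the integral over \<open>z\<close> of the square of \<open>\<integral> gaussian (2 t) x z s(x) dx\<close>.\<close>

lemma gaussian_energy_nonneg:
  assumes t: "0 < t"
  shows "0 \<le> (LINT p|(L \<Otimes>\<^sub>M L). gaussian t (fst p) (snd p) * (s (fst p) * s (snd p)))"
proof -
  interpret P: pair_sigma_finite "L \<Otimes>\<^sub>M L" "lborel :: R2 measure" ..
  define h where "h p z = (gaussian (2 * t) (fst p) z * s (fst p)) * (gaussian (2 * t) (snd p) z * s (snd p))" for p z
  have h_eq: "h p z = gaussian t (fst p) (snd p) * (s (fst p) * s (snd p)) * gaussian (4 * t) z ((1 / 2) *\<^sub>R (fst p + snd p))" for p z
    using gaussian_mult_gaussian[of t "fst p" z "snd p"] unfolding h_def by (simp add: algebra_simps)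
  have g: "has_bochner_integral lborel (\<lambda>z. gaussian (4 * t) z m) (pi / (4 * t))" for m
    using t by (intro has_bochner_integral_gaussian) simp
  have hz: "has_bochner_integral lborel (h p) (gaussian t (fst p) (snd p) * (s (fst p) * s (snd p)) * (pi / (4 * t)))" for p
    unfolding h_eq by (intro has_bochner_integral_mult_right g)
  have intE: "integrable (L \<Otimes>\<^sub>M L) (\<lambda>p. gaussian t (fst p) (snd p) * (s (fst p) * s (snd p)))"
    using t by (intro integrable_bounded_mult integrable_pair_charge) (auto simp: mult_nonneg_nonneg)
  have int: "integrable ((L \<Otimes>\<^sub>M L) \<Otimes>\<^sub>M lborel) (\<lambda>(p, z). h p z)"
  proof (rule P.Fubini_integrable)
    show "(\<lambda>(p, z). h p z) \<in> borel_measurable ((L \<Otimes>\<^sub>M L) \<Otimes>\<^sub>M lborel)"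
      unfolding h_def by measurable
    have "(LINT z|lborel. norm (h p z)) = \<bar>gaussian t (fst p) (snd p) * (s (fst p) * s (snd p))\<bar> * (pi / (4 * t))" for p
      unfolding h_eq abs_mult real_norm_def
      using has_bochner_integral_integral_eq[OF g] by simp
    then show "integrable (L \<Otimes>\<^sub>M L) (\<lambda>p. LINT z|lborel. norm (case (p, z) of (p, z) \<Rightarrow> h p z))"
      using intE by simp
    show "AE p in L \<Otimes>\<^sub>M L. integrable lborel (\<lambda>z. case (p, z) of (p, z) \<Rightarrow> h p z)"
      using hz by (auto simp: has_bochner_integral_iff)
  qed
  have "(LINT p|(L \<Otimes>\<^sub>M L). h p z) = (LINT x|L. gaussian (2 * t) x z * s x)\<^sup>2" for z
  proof -
    have "integrable L (\<lambda>x. gaussian (2 * t) x z * s x)"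
      using t by (intro integrable_bounded_mult integrable_charge) (auto simp: mult_nonneg_nonneg)
    from integral_product_mult[OF this this] show ?thesis
      by (simp add: h_def case_prod_beta' power2_eq_square)
  qed
  then have "0 \<le> (LINT z|lborel. LINT p|(L \<Otimes>\<^sub>M L). h p z)"
    by simp
  also have "\<dots> = (LINT p|(L \<Otimes>\<^sub>M L). LINT z|lborel. h p z)"
    using P.Fubini_integral[OF int] .
  also have "\<dots> = (LINT p|(L \<Otimes>\<^sub>M L). gaussian t (fst p) (snd p) * (s (fst p) * s (snd p))) * (pi / (4 * t))"
    using has_bochner_integral_integral_eq[OF hz] by simp
  finally have "0 \<le> (LINT p|(L \<Otimes>\<^sub>M L). gaussian t (fst p) (snd p) * (s (fst p) * s (snd p))) * (pi / (4 * t))" .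
  moreover have "0 < pi / (4 * t)" using t by simp
  moreover have "0 \<le> x" if "0 \<le> x * c" "0 < c" for x c :: real
    using that by (simp add: zero_le_mult_iff)
  ultimately show ?thesis by blast
qed

text \<open>The self-interaction that the off-diagonal energy omits: the sum of the squared point
  charges, evaluated in \<open>self_mass_eq\<close>.\<close>

definition self_mass :: real where
  "self_mass = (LINT p|(L \<Otimes>\<^sub>M L). indicator diagonal p * (s (fst p) * s (snd p)))"

definition \<Phi> :: "real \<Rightarrow> real" where
  "\<Phi> t = (LINT p|(L \<Otimes>\<^sub>M L). indicator (- diagonal) p * (gaussian t (fst p) (snd p) - exp (- t)) * (s (fst p) * s (snd p)))"

lemma integrable_gaussian_energy:
  "0 < t \<Longrightarrow> integrable (L \<Otimes>\<^sub>M L) (\<lambda>p. gaussian t (fst p) (snd p) * (s (fst p) * s (snd p)))"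
  by (intro integrable_bounded_mult integrable_pair_charge) (auto simp: mult_nonneg_nonneg)

lemma integrable_diagonal: "integrable (L \<Otimes>\<^sub>M L) (\<lambda>p. indicator diagonal p * (s (fst p) * s (snd p)))"
  by (intro integrable_bounded_mult integrable_pair_charge) (auto simp: indicator_def)

text \<open>On the diagonal the kernel equals \<open>1 - exp (- t)\<close>, whence the subtracted
  term; over the full product the constant \<open>exp (- t)\<close> integrates to 0 by
  neutrality.\<close>

lemma \<Phi>_eq:
  assumes t: "0 < t"
  shows "\<Phi> t = (LINT p|(L \<Otimes>\<^sub>M L). gaussian t (fst p) (snd p) * (s (fst p) * s (snd p))) - (1 - exp (- t)) * self_mass"
proof -
  have "\<Phi> t = (LINT p|(L \<Otimes>\<^sub>M L). gaussian t (fst p) (snd p) * (s (fst p) * s (snd p))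
      - exp (- t) * (s (fst p) * s (snd p)) - (1 - exp (- t)) * (indicator diagonal p * (s (fst p) * s (snd p))))"
    unfolding \<Phi>_def by (intro Bochner_Integration.integral_cong) (auto simp: indicator_def diagonal_eq algebra_simps)
  then show ?thesis
    using integrable_gaussian_energy[OF t] integrable_pair_charge integrable_diagonal
    by (simp add: integral_pair_charge self_mass_def)
qed

lemma \<Phi>_ge_self_mass: "0 < t \<Longrightarrow> - ((1 - exp (- t)) * self_mass) \<le> \<Phi> t"
  using gaussian_energy_nonneg[of t] by (simp add: \<Phi>_eq)

text \<open>A negative product always contains the positive part of one factor. \<open>K\<close>
  bounds the Gaussian potential of that positive part, and the other factor contributes its total
  variation; either order occurs, hence the 2.\<close>

lemma \<Phi>_ge_inverse:
  assumes t: "0 < t" and d: "0 \<le> self_mass"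
    and K: "\<And>y. (LINT x|L. gaussian t x y * max 0 (s x)) \<le> K * pi / t"
  shows "- (2 * K * pi * (LINT x|L. \<bar>s x\<bar>) / t) \<le> \<Phi> t"
proof -
  define a where "a p = gaussian t (fst p) (snd p) * (max 0 (s (fst p)) * \<bar>s (snd p)\<bar>)" for p
  define b where "b p = gaussian t (fst p) (snd p) * (\<bar>s (fst p)\<bar> * max 0 (s (snd p)))" for p
  have pair: "integrable (L \<Otimes>\<^sub>M L) (\<lambda>p. max 0 (s (fst p)) * \<bar>s (snd p)\<bar>)" "integrable (L \<Otimes>\<^sub>M L) (\<lambda>p. \<bar>s (fst p)\<bar> * max 0 (s (snd p)))"
    using integrable_product_mult[of "\<lambda>x. max 0 (s x)" "\<lambda>x. \<bar>s x\<bar>"] integrable_product_mult[of "\<lambda>x. \<bar>s x\<bar>" "\<lambda>x. max 0 (s x)"]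
      integrable_charge by (simp_all add: case_prod_beta')
  have int: "integrable (L \<Otimes>\<^sub>M L) a" "integrable (L \<Otimes>\<^sub>M L) b"
    unfolding a_def b_def using t by (auto intro!: integrable_bounded_mult pair simp: mult_nonneg_nonneg)
  have le: "(LINT y|L. \<bar>s y\<bar> * (LINT x|L. gaussian t x y * max 0 (s x))) \<le> K * pi / t * (LINT x|L. \<bar>s x\<bar>)"
    if "integrable L (\<lambda>y. \<bar>s y\<bar> * (LINT x|L. gaussian t x y * max 0 (s x)))"
  proof -
    have "(LINT y|L. \<bar>s y\<bar> * (LINT x|L. gaussian t x y * max 0 (s x))) \<le> (LINT y|L. \<bar>s y\<bar> * (K * pi / t))"
      using that integrable_charge by (intro integral_mono mult_left_mono K) auto
    then show ?thesis using integrable_charge by (simp add: mult.commute)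
  qed
  have a_fst: "(LINT x|L. a (x, y)) = \<bar>s y\<bar> * (LINT x|L. gaussian t x y * max 0 (s x))" for y
    unfolding a_def by (subst integral_mult_right_zero[symmetric]) (simp add: ac_simps)
  have b_snd: "(LINT y|L. b (x, y)) = \<bar>s x\<bar> * (LINT y|L. gaussian t y x * max 0 (s y))" for x
    unfolding b_def by (subst integral_mult_right_zero[symmetric]) (simp add: ac_simps norm_minus_commute)
  have "(LINT p|(L \<Otimes>\<^sub>M L). a p) \<le> K * pi / t * (LINT x|L. \<bar>s x\<bar>)"
    using int(1) integral_snd[of "\<lambda>x y. a (x, y)"] integrable_snd[of "\<lambda>x y. a (x, y)"] le by (simp add: a_fst)
  moreover have "(LINT p|(L \<Otimes>\<^sub>M L). b p) \<le> K * pi / t * (LINT x|L. \<bar>s x\<bar>)"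
    using int(2) integral_fst[of "\<lambda>x y. b (x, y)"] integrable_fst[of "\<lambda>x y. b (x, y)"] le by (simp add: b_snd)
  ultimately have "(LINT p|(L \<Otimes>\<^sub>M L). a p + b p) \<le> K * pi / t * (LINT x|L. \<bar>s x\<bar>) + K * pi / t * (LINT x|L. \<bar>s x\<bar>)"
    using int by simp
  also have "\<dots> = 2 * K * pi * (LINT x|L. \<bar>s x\<bar>) / t"
    by (simp add: field_simps)
  finally have ab: "(LINT p|(L \<Otimes>\<^sub>M L). a p + b p) \<le> 2 * K * pi * (LINT x|L. \<bar>s x\<bar>) / t" .
  \<comment> \<open>Neutrality turns the off-diagonal integral of \<open>- exp (- t)\<close> against
    the pair charge into \<open>exp (- t) * self_mass\<close>, which has the favourable sign by
    \<open>d\<close>.\<close>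
  have "- (LINT p|(L \<Otimes>\<^sub>M L). a p + b p) + exp (- t) * self_mass
    = (LINT p|(L \<Otimes>\<^sub>M L). - (a p + b p) + exp (- t) * (indicator diagonal p * (s (fst p) * s (snd p)))
        - exp (- t) * (s (fst p) * s (snd p)))"
    using int integrable_diagonal integrable_pair_charge by (simp add: self_mass_def integral_pair_charge)
  also have "\<dots> \<le> \<Phi> t"
    unfolding \<Phi>_def
  proof (rule integral_mono)
    have "integrable (L \<Otimes>\<^sub>M L) (\<lambda>p. gaussian t (fst p) (snd p) * (s (fst p) * s (snd p))
      - exp (- t) * (s (fst p) * s (snd p)) - (1 - exp (- t)) * (indicator diagonal p * (s (fst p) * s (snd p))))"
      using integrable_gaussian_energy[OF t] integrable_pair_charge integrable_diagonal by simp
    then show "integrable (L \<Otimes>\<^sub>M L) (\<lambda>p. indicator (- diagonal) p * (gaussian t (fst p) (snd p) - exp (- t)) * (s (fst p) * s (snd p)))"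
      by (rule Bochner_Integration.integrable_cong[THEN iffD1, rotated 2]) (auto simp: indicator_def diagonal_eq algebra_simps)
    fix p
    have *: "- (max 0 u * \<bar>v\<bar> + \<bar>u\<bar> * max 0 v) \<le> u * v" for u v :: real
      by (cases "0 \<le> u"; cases "0 \<le> v") (auto simp: max_def mult_nonneg_nonneg mult_nonpos_nonpos abs_if)
    have "- (a p + b p) = gaussian t (fst p) (snd p) * - (max 0 (s (fst p)) * \<bar>s (snd p)\<bar> + \<bar>s (fst p)\<bar> * max 0 (s (snd p)))"
      by (simp add: a_def b_def algebra_simps)
    also have "\<dots> \<le> gaussian t (fst p) (snd p) * (s (fst p) * s (snd p))"
      by (intro mult_left_mono *) simp
    moreover have "0 \<le> a p + b p"
      by (simp add: a_def b_def)
    ultimately show "- (a p + b p) + exp (- t) * (indicator diagonal p * (s (fst p) * s (snd p))) - exp (- t) * (s (fst p) * s (snd p))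
      \<le> indicator (- diagonal) p * (gaussian t (fst p) (snd p) - exp (- t)) * (s (fst p) * s (snd p))"
      by (cases "p \<in> diagonal") (simp_all add: algebra_simps)
  qed (use int integrable_diagonal integrable_pair_charge in simp)
  finally show ?thesis
    using ab mult_nonneg_nonneg[OF exp_ge_zero[of "- t"] d] by linarith
qed

text \<open>Frullani with \<open>a = r\<^sup>2\<close>, \<open>b = 1\<close> represents
  \<open>- 2 * ln r\<close>, which is \<open>4 * pi\<close> times \<open>g\<close>. Fubini exchanges
  \<open>t\<close> with the pair because \<open>nn_integral_abs_frullani\<close> gives the absolute
  integral as \<open>2 * \<bar>ln r\<bar>\<close>, covered by \<open>integrable_log\<close>.\<close>

lemma integrable_\<Phi>_and_energy_eq:
  "integrable lborel (\<lambda>t. indicator {0<..} t * (\<Phi> t / t))"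
  "(LINT p|(L \<Otimes>\<^sub>M L). s (fst p) * s (snd p) * g (fst p - snd p))
    = 1 / (4 * pi) * (LINT t|lborel. indicator {0<..} t * (\<Phi> t / t))"
proof -
  interpret P: pair_sigma_finite "L \<Otimes>\<^sub>M L" "lborel :: real measure" ..
  define r where "r p = norm (fst p - snd p)" for p :: "R2 \<times> R2"
  define F where "F p t = indicator {0<..} t * ((exp (- (r p)\<^sup>2 * t) - exp (- 1 * t)) / t)" for p and t :: real
  define k where "k p t = indicator (- diagonal) p * (s (fst p) * s (snd p)) *
F p t" for p t
  have r: "r p > 0" if "p \<notin> diagonal" for p
    using that unfolding r_def diagonal_eq by simp
  have hk: "has_bochner_integral lborel (k p) (s (fst p) * s (snd p) * (- 2 * ln (r p)))" for p
  proof (cases "p \<in> diagonal")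
    \<comment> \<open>Both sides vanish on the diagonal: \<open>k\<close> by its indicator, the
      value by \<open>ln 0 = 0\<close>.\<close>
    case True
    then have "k p = (\<lambda>t. 0)" by (simp add: k_def fun_eq_iff)
    with True show ?thesis by (simp add: r_def diagonal_eq has_bochner_integral_zero)
  next
    case False
    then have "ln 1 - ln ((r p)\<^sup>2) = - 2 * ln (r p)"
      using r by (simp add: ln_realpow)
    then have "has_bochner_integral lborel (F p) (- 2 * ln (r p))"
      using has_bochner_integral_frullani[of "(r p)\<^sup>2" 1] r[OF False] by (simp add: F_def[abs_def])
    then have "has_bochner_integral lborel (\<lambda>t. s (fst p) * s (snd p) * F p t) (s (fst p) * s (snd p) * (- 2 * ln (r p)))"
      by (rule has_bochner_integral_mult_right)
    moreover have "k p = (\<lambda>t. s (fst p) * s (snd p) * F p t)"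
      using False by (simp add: k_def fun_eq_iff)
    ultimately show ?thesis by simp
  qed
  have norm_k: "(LINT t|lborel. norm (k p t)) = \<bar>s (fst p) * s (snd p) * ln (r p)\<bar> * 2" for p
  proof (cases "p \<in> diagonal")
    case True
    then show ?thesis by (simp add: k_def r_def diagonal_eq)
  next
    case False
    then have "ln 1 - ln ((r p)\<^sup>2) = - 2 * ln (r p)"
      using r by (simp add: ln_realpow)
    then have "(\<integral>\<^sup>+t. ennreal \<bar>F p t\<bar> \<partial>lborel) = ennreal (2 * \<bar>ln (r p)\<bar>)"
      using nn_integral_abs_frullani[of "(r p)\<^sup>2" 1] r[OF False] by (simp add: F_def abs_mult)
    moreover have "F p \<in> borel_measurable borel"
      unfolding F_def by measurable
    ultimately have "(LINT t|lborel. \<bar>F p t\<bar>) = 2 * \<bar>ln (r p)\<bar>"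
      by (intro has_bochner_integral_integral_eq has_bochner_integral_nn_integral) auto
    moreover have "norm (k p t) = \<bar>s (fst p) * s (snd p)\<bar> * \<bar>F p t\<bar>" for t
      using False unfolding k_def real_norm_def by (subst abs_mult) simp
    ultimately show ?thesis by (simp add: abs_mult)
  qed
  have int: "integrable ((L \<Otimes>\<^sub>M L) \<Otimes>\<^sub>M lborel) (\<lambda>(p, t). k p t)"
  proof (rule P.Fubini_integrable)
    show "(\<lambda>(p, t). k p t) \<in> borel_measurable ((L \<Otimes>\<^sub>M L) \<Otimes>\<^sub>M lborel)"
      unfolding k_def F_def r_def by measurable
    show "integrable (L \<Otimes>\<^sub>M L) (\<lambda>p. LINT t|lborel. norm (case (p, t) of (p, t) \<Rightarrow> k p t))"
      unfolding prod.case norm_k r_def by (intro integrable_mult_left integrable_abs integrable_log)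
    show "AE p in L \<Otimes>\<^sub>M L. integrable lborel (\<lambda>t. case (p, t) of (p, t) \<Rightarrow> k p t)"
      unfolding prod.case by (intro AE_I2 integrable.intros[OF hk])
  qed
  have k_p: "(LINT p|(L \<Otimes>\<^sub>M L). k p t) = indicator {0<..} t * (\<Phi> t / t)" for t
  proof -
    have "k p t = indicator {0<..} t / t * (indicator (- diagonal) p *
      (gaussian t (fst p) (snd p) - exp (- t)) * (s (fst p) * s (snd p)))" for p
      unfolding k_def F_def r_def by (simp add: mult.commute[of t])
    then have "(LINT p|(L \<Otimes>\<^sub>M L). k p t) = (LINT p|(L \<Otimes>\<^sub>M L). indicator {0<..} t / t * (indicator (- diagonal) p *
      (gaussian t (fst p) (snd p) - exp (- t)) * (s (fst p) * s (snd p))))"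
      by (simp only:)
    also have "\<dots> = indicator {0<..} t / t * \<Phi> t"
      unfolding \<Phi>_def by (rule integral_mult_right_zero)
    finally show ?thesis by simp
  qed
  show "integrable lborel (\<lambda>t. indicator {0<..} t * (\<Phi> t / t))"
    using P.integrable_snd[OF int] by (simp add: k_p)
  have "(LINT p|(L \<Otimes>\<^sub>M L). s (fst p) * s (snd p) * g (fst p - snd p))
    = (LINT p|(L \<Otimes>\<^sub>M L). 1 / (4 * pi) * (LINT t|lborel. k p t))"
    using has_bochner_integral_integral_eq[OF hk]
    by (intro Bochner_Integration.integral_cong) (auto simp: g_def r_def)
  also have "\<dots> = 1 / (4 * pi) * (LINT p|(L \<Otimes>\<^sub>M L). (LINT t|lborel. k p t))"
    by (rule integral_mult_right_zero)
  also have "(LINT p|(L \<Otimes>\<^sub>M L). (LINT t|lborel. k p t)) = (LINT t|lborel. indicator {0<..} t * (\<Phi> t / t))"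
    using P.Fubini_integral[OF int] by (simp add: k_p)
  finally show "(LINT p|(L \<Otimes>\<^sub>M L). s (fst p) * s (snd p) * g (fst p - snd p))
    = 1 / (4 * pi) * (LINT t|lborel. indicator {0<..} t * (\<Phi> t / t))" .
qed

text \<open>A nonpositive self-mass, as for a charge without atoms, removes the loss in
  \<open>\<Phi>_ge_self_mass\<close>.\<close>

lemma energy_nonneg:
  assumes "self_mass \<le> 0"
  shows "0 \<le> (LINT p|(L \<Otimes>\<^sub>M L). s (fst p) * s (snd p) * g (fst p - snd p))"
proof -
  have "0 \<le> \<Phi> t" if "0 < t" for t
  proof -
    have "(1 - exp (- t)) * self_mass \<le> 0"
      using that assms by (intro mult_nonneg_nonpos) auto
    then show ?thesis using \<Phi>_ge_self_mass[OF that] by linarith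
  qed
  then have "0 \<le> (LINT t|lborel. indicator {0<..} t * (\<Phi> t / t))"
    by (intro integral_nonneg_AE AE_I2) (auto simp: indicator_def)
  then show ?thesis
    by (simp add: integrable_\<Phi>_and_energy_eq(2))
qed

text \<open>The summand \<open>D\<close> comes from \<open>t < 1\<close>, the other one from
  \<open>t \<ge> 1\<close>, where \<open>1 / (1 - \<gamma>)\<close> is the integral of the
  interpolated decay.\<close>

lemma energy_ge:
  fixes \<gamma> C D :: real
  assumes D: "self_mass \<le> D" "0 \<le> D" and C: "\<And>t. 1 \<le> t \<Longrightarrow> - (C / t) \<le> \<Phi> t" "0 \<le> C"
    and \<gamma>: "0 < \<gamma>" "\<gamma> < 1"
  shows "- (1 / (4 * pi) * (D + D powr \<gamma> * C powr (1 - \<gamma>) / (1 - \<gamma>)))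
    \<le> (LINT p|(L \<Otimes>\<^sub>M L). s (fst p) * s (snd p) * g (fst p - snd p))"
proof -
  \<comment> \<open>The exponent weights the decay \<open>1 / t\<close> by \<open>\<gamma>\<close>
    and \<open>1 / t\<^sup>2\<close> by \<open>1 - \<gamma>\<close>:
    \<open>- \<gamma> - 2 * (1 - \<gamma>) = \<gamma> - 2\<close>.\<close>
  have tail: "has_bochner_integral lborel (\<lambda>t. indicator {1..} t * t powr (\<gamma> - 2)) (1 / (1 - \<gamma>))"
  proof (rule has_bochner_integral_nn_integral)
    have "((\<lambda>t::real. t powr (\<gamma> - 1) / (\<gamma> - 1)) \<longlongrightarrow> 0) at_top"
      using \<gamma> by real_asymp
    then have "(\<integral>\<^sup>+t. ennreal (t powr (\<gamma> - 2)) * indicator {1..} t \<partial>lborel) = ennreal (0 - 1 powr (\<gamma> - 1) / (\<gamma> - 1))"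
      using \<gamma> by (intro nn_integral_FTC_atLeast) (auto intro!: derivative_eq_intros)
    moreover have "0 - 1 powr (\<gamma> - 1) / (\<gamma> - 1) = 1 / (1 - \<gamma>)"
      using \<gamma> by (simp add: field_simps)
    moreover have "(\<integral>\<^sup>+t. ennreal (indicator {1..} t * t powr (\<gamma> - 2)) \<partial>lborel)
      = (\<integral>\<^sup>+t. ennreal (t powr (\<gamma> - 2)) * indicator {1..} t \<partial>lborel)"
      by (intro nn_integral_cong) (auto simp: indicator_def)
    ultimately show "(\<integral>\<^sup>+t. ennreal (indicator {1..} t * t powr (\<gamma> - 2)) \<partial>lborel) = ennreal (1 / (1 - \<gamma>))"
      by simp
  qed (use \<gamma> in auto)
  define E where "E = D powr \<gamma> * C powr (1 - \<gamma>)"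
  have "has_bochner_integral lborel (\<lambda>t. indicator {0..1::real} t * D) (1 * D)"
    by (intro has_bochner_integral_mult_left) (simp_all add: has_bochner_integral_iff)
  moreover have "has_bochner_integral lborel (\<lambda>t. E * (indicator {1..} t * t powr (\<gamma> - 2))) (E * (1 / (1 - \<gamma>)))"
    by (intro has_bochner_integral_mult_right tail)
  ultimately have "has_bochner_integral lborel (\<lambda>t. indicator {0..1} t * D + E * (indicator {1..} t * t powr (\<gamma> - 2))) (1 * D + E * (1 / (1 - \<gamma>)))"
    by (rule has_bochner_integral_add)
  from has_bochner_integral_minus[OF this]
  have w: "has_bochner_integral lborel (\<lambda>t. - (indicator {0..1} t * D + E * (indicator {1..} t * t powr (\<gamma> - 2)))) (- (D + E / (1 - \<gamma>)))"
    by simp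
  have "- (D + E / (1 - \<gamma>)) = (LINT t|lborel. - (indicator {0..1} t * D + E * (indicator {1..} t * t powr (\<gamma> - 2))))"
    using w by (simp add: has_bochner_integral_iff)
  also have "\<dots> \<le> (LINT t|lborel. indicator {0<..} t * (\<Phi> t / t))"
  proof (rule integral_mono)
    fix t :: real
    have E: "0 \<le> E" by (simp add: E_def)
    consider "t \<le> 0" | "0 < t" "t < 1" | "1 \<le> t" by linarith
    then show "- (indicator {0..1} t * D + E * (indicator {1..} t * t powr (\<gamma> - 2))) \<le> indicator {0<..} t * (\<Phi> t / t)"
    proof cases
      case 1
      then show ?thesis using E D(2) by (auto simp: indicator_def)
    next
      case 2
      have "(1 - exp (- t)) * self_mass \<le> (1 - exp (- t)) * D"
        using 2 D by (intro mult_left_mono) auto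
      \<comment> \<open>\<open>1 - exp (- t) \<le> t\<close> cancels the singularity of
        \<open>1 / t\<close> at 0.\<close>
      also have "\<dots> \<le> t * D"
        using D exp_ge_add_one_self[of "- t"] by (intro mult_right_mono) auto
      finally have "- (t * D) \<le> \<Phi> t" using \<Phi>_ge_self_mass[OF 2(1)] by linarith
      then show ?thesis using 2 by (simp add: field_simps)
    next
      case 3
      then have "0 < t" by simp
      have "- (\<Phi> t / t) \<le> E * t powr (\<gamma> - 2)"
      \<comment> \<open>The split ensures a positive base for the powers; for nonnegative
        \<open>\<Phi> t\<close> the bound is trivial.\<close>
      proof (cases "\<Phi> t < 0")
        case True
        have "(1 - exp (- t)) * self_mass \<le> (1 - exp (- t)) * D"
          using 3 D by (intro mult_left_mono) auto
        also have "\<dots> \<le> 1 * D"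
          using D by (intro mult_right_mono) auto
        finally have "- \<Phi> t \<le> D" using \<Phi>_ge_self_mass[OF \<open>0 < t\<close>] by linarith
        then have "- \<Phi> t / t \<le> D / t"
          using \<open>0 < t\<close> by (intro divide_right_mono) auto
        then have uD: "- (\<Phi> t / t) \<le> D / t" by simp
        have "- \<Phi> t \<le> C / t" using C(1)[OF 3] by simp
        then have "- \<Phi> t / t \<le> C / t / t" using \<open>0 < t\<close> by (intro divide_right_mono) auto
        then have uC: "- (\<Phi> t / t) \<le> C / t powr 2"
          using \<open>0 < t\<close> by (simp add: power2_eq_square)
        have u: "0 < - (\<Phi> t / t)" using True \<open>0 < t\<close> by (simp add: divide_neg_pos)
        \<comment> \<open>interpolate between the two bounds: \<open>min a b \<le> a\<^sup>\<gamma> b\<^sup>1\<^sup>-\<^sup>\<gamma>\<close>\<close>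
        have "x = x powr \<gamma> * x powr (1 - \<gamma>)" if "0 < x" for x :: real
          using that powr_add[of x \<gamma> "1 - \<gamma>"] by simp
        from this[OF u] have "- (\<Phi> t / t) = (- (\<Phi> t / t)) powr \<gamma> * (- (\<Phi> t / t)) powr (1 - \<gamma>)" .
        also have "\<dots> \<le> (D / t) powr \<gamma> * (C / t powr 2) powr (1 - \<gamma>)"
          using u uD uC \<gamma> by (intro mult_mono powr_mono2) auto
        also have "(D / t) powr \<gamma> = D powr \<gamma> * t powr (- \<gamma>)"
          using \<open>0 < t\<close> D(2) by (simp add: powr_divide powr_minus_divide)
        also have "(C / t powr 2) powr (1 - \<gamma>) = C powr (1 - \<gamma>) * t powr (- 2 * (1 - \<gamma>))"
          using \<open>0 < t\<close> C(2) by (subst powr_divide) (simp_all only: powr_ge_zero powr_powr powr_minus_divide mult_minus_left times_divide_eq_right mult_1_right)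
        also have "D powr \<gamma> * t powr (- \<gamma>) * (C powr (1 - \<gamma>) * t powr (- 2 * (1 - \<gamma>)))
          = E * (t powr (- \<gamma>) * t powr (- 2 * (1 - \<gamma>)))"
          unfolding E_def by (simp only: mult_ac)
        also have "t powr (- \<gamma>) * t powr (- 2 * (1 - \<gamma>)) = t powr (- \<gamma> + - 2 * (1 - \<gamma>))"
          by (rule powr_add[symmetric])
        also have "- \<gamma> + - 2 * (1 - \<gamma>) = \<gamma> - 2" by simp
        finally show ?thesis .
      next
        case False
        then have "0 \<le> \<Phi> t / t" using \<open>0 < t\<close> by simp
        moreover have "0 \<le> E * t powr (\<gamma> - 2)" using E by simp
        ultimately show ?thesis by linarith
      qed
      moreover have "0 \<le> indicator {0..1} t * D" using D(2) by simp
      ultimately show ?thesis using 3 by simp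
    qed
  qed (use w integrable_\<Phi>_and_energy_eq(1) in \<open>auto simp: has_bochner_integral_iff\<close>)
  finally have "1 / (4 * pi) * - (D + E / (1 - \<gamma>)) \<le> 1 / (4 * pi) * (LINT t|lborel. indicator {0<..} t * (\<Phi> t / t))"
    by (intro mult_left_mono) auto
  then show ?thesis
    by (simp only: integrable_\<Phi>_and_energy_eq(2) E_def mult_minus_right)
qed

end

section \<open>Point charges in a bounded background\<close>

text \<open>Lebesgue measure plus counting measure on \<open>Q\<close>: a reference measure for which the background
  and the point charges together form a single density.\<close>

definition point_charge_base :: "R2 set \<Rightarrow> R2 measure" where
  "point_charge_base Q = add_measure lborel (distr (count_space Q) borel (\<lambda>x. x))"

lemma sets_point_charge_base [simp, measurable_cong]: "sets (point_charge_base Q) = sets borel"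
  by (simp add: point_charge_base_def)

lemma nn_integral_point_charge_base:
  assumes "finite Q" and [measurable]: "f \<in> borel_measurable borel"
  shows "(\<integral>\<^sup>+x. f x \<partial>point_charge_base Q) = (\<integral>\<^sup>+x. f x \<partial>lborel) + (\<Sum>q\<in>Q. f q)"
  unfolding point_charge_base_def using assms(1)
  by (simp add: nn_integral_add_measure nn_integral_distr nn_integral_count_space_finite)

lemma point_charge_base_empty: "point_charge_base {} = lborel"
proof (rule measure_eqI)
  fix A assume "A \<in> sets (point_charge_base {})"
  then have A: "A \<in> sets borel" by simp
  then have "emeasure (point_charge_base {}) A = (\<integral>\<^sup>+x. indicator A x \<partial>point_charge_base {})"
    by (intro nn_integral_indicator[symmetric]) simp
  also have "\<dots> = emeasure lborel A"
    using A by (subst nn_integral_point_charge_base) auto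
  finally show "emeasure (point_charge_base {}) A = emeasure lborel A" .
qed simp

lemma sigma_finite_point_charge_base:
  assumes Q: "finite Q"
  shows "sigma_finite_measure (point_charge_base Q)"
proof
  obtain A :: "R2 set set" where A: "countable A" "A \<subseteq> sets lborel" "\<Union>A = space lborel" "\<forall>a\<in>A. emeasure lborel a \<noteq> \<infinity>"
    using lborel.sigma_finite_countable by blast
  have "emeasure (point_charge_base Q) a \<noteq> \<infinity>" if "a \<in> A" for a
  proof -
    have a: "a \<in> sets borel" using A(2) that by auto
    then have "emeasure (point_charge_base Q) a = (\<integral>\<^sup>+x. indicator a x \<partial>point_charge_base Q)"
      by (intro nn_integral_indicator[symmetric]) simp
    also have "\<dots> = emeasure lborel a + (\<Sum>q\<in>Q. indicator a q)"
      using a Q by (subst nn_integral_point_charge_base) auto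
    finally show ?thesis using A(4) that Q by (auto simp: indicator_def)
  qed
  moreover have "space (point_charge_base Q) = space lborel"
    by (simp add: point_charge_base_def)
  ultimately show "\<exists>A. countable A \<and> A \<subseteq> sets (point_charge_base Q) \<and> \<Union>A = space (point_charge_base Q)
      \<and> (\<forall>a\<in>A. emeasure (point_charge_base Q) a \<noteq> \<infinity>)"
    using A by (intro exI[of _ A]) auto
qed

lemma has_bochner_integral_point_charge_base:
  fixes h :: "R2 \<Rightarrow> real"
  assumes Q: "finite Q" and h: "integrable lborel h"
  shows "has_bochner_integral (point_charge_base Q) h ((LINT x|lborel. h x) + (\<Sum>q\<in>Q. h q))"
proof -
  have *: "has_bochner_integral (point_charge_base Q) u ((LINT x|lborel. u x) + (\<Sum>q\<in>Q. u q))"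
    if u: "integrable lborel u" and nonneg: "\<And>x. 0 \<le> u x" for u :: "R2 \<Rightarrow> real"
  proof (rule has_bochner_integral_nn_integral)
    have [measurable]: "u \<in> borel_measurable borel" using u by simp
    show "u \<in> borel_measurable (point_charge_base Q)" by measurable
    show "(\<integral>\<^sup>+x. ennreal (u x) \<partial>point_charge_base Q) = ennreal ((LINT x|lborel. u x) + (\<Sum>q\<in>Q. u q))"
      using u Q nonneg
      by (simp add: nn_integral_point_charge_base nn_integral_eq_integral sum_nonneg)
  qed (use nonneg in \<open>auto intro!: add_nonneg_nonneg sum_nonneg\<close>)
  have pm: "max 0 r - max 0 (- r) = r" for r :: real
    by (simp add: max_def)
  have "has_bochner_integral (point_charge_base Q) (\<lambda>x. max 0 (h x) - max 0 (- h x))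
    (((LINT x|lborel. max 0 (h x)) + (\<Sum>q\<in>Q. max 0 (h q))) - ((LINT x|lborel. max 0 (- h x)) + (\<Sum>q\<in>Q. max 0 (- h q))))"
    using h by (intro has_bochner_integral_diff *) auto
  also have "((LINT x|lborel. max 0 (h x)) + (\<Sum>q\<in>Q. max 0 (h q))) - ((LINT x|lborel. max 0 (- h x)) + (\<Sum>q\<in>Q. max 0 (- h q)))
    = (LINT x|lborel. max 0 (h x) - max 0 (- h x)) + (\<Sum>q\<in>Q. max 0 (h q) - max 0 (- h q))"
    using h by (subst Bochner_Integration.integral_diff) (auto simp: sum_subtractf)
  finally show ?thesis unfolding pm .
qed

lemma AE_lborel_not_in_finite: "finite Q \<Longrightarrow> AE x in lborel. (x :: R2) \<notin> Q"
  by (intro AE_not_in finite_imp_null_set_lborel)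

text \<open>A finite set is Lebesgue null, so only the counting part of the base sees
  \<open>h\<close>.\<close>

lemma integral_point_charge_base_AE_0:
  fixes h :: "R2 \<Rightarrow> real"
  assumes Q: "finite Q" and h: "h \<in> borel_measurable borel" "\<And>x. x \<notin> Q \<Longrightarrow> h x = 0"
  shows "(LINT x|point_charge_base Q. h x) = (\<Sum>q\<in>Q. h q)"
proof -
  have 0: "AE x in lborel. h x = 0"
    using AE_lborel_not_in_finite[OF Q] h(2) by (auto elim!: eventually_mono)
  have "integrable lborel h" "(LINT x|lborel. h x) = 0"
    using h(1) 0 integrable_cong_AE[of h lborel "\<lambda>x. 0"] integral_cong_AE[of h lborel "\<lambda>x. 0"] by auto
  then show ?thesis
    using has_bochner_integral_integral_eq[OF has_bochner_integral_point_charge_base[OF Q]] by simp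
qed

text \<open>The signed measure is \<open>f\<close> times Lebesgue measure minus weight
  \<open>c\<close> at each point of \<open>Q\<close>. Taking \<open>Q\<close> as a set encodes that
  the points are distinct; \<open>Q = {}\<close> with \<open>c = 0\<close> covers a pure
  density.\<close>

locale charged_points =
  fixes Q :: "R2 set" and f :: "R2 \<Rightarrow> real" and c K R :: real
  assumes finite_points: "finite Q" and weight: "0 \<le> c"
    and integrable_f: "integrable lborel f"
    and bounded_f: "AE x in lborel. \<bar>f x\<bar> \<le> K" and K: "0 \<le> K"
    and support_f: "AE x in lborel. f x \<noteq> 0 \<longrightarrow> norm x \<le> R" and R: "0 \<le> R"
    and total_charge: "(LINT x|lborel. f x) = c * card Q"
begin

abbreviation base :: "R2 measure" where "base \<equiv> point_charge_base Q"

text \<open>The value on \<open>Q\<close> is seen by the counting measure alone, since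
  \<open>Q\<close> is Lebesgue null; overwriting \<open>f\<close> there leaves the background
  unchanged.\<close>

definition charge :: "R2 \<Rightarrow> real" where "charge x = (if x \<in> Q then - c else f x)"

lemma measurable_f [measurable]: "f \<in> borel_measurable borel"
  using integrable_f by simp

lemma borel_Q [measurable]: "Q \<in> sets borel"
  using finite_points by (intro borel_closed finite_imp_closed)

lemma measurable_charge [measurable]: "charge \<in> borel_measurable borel"
  unfolding charge_def[abs_def] by measurable

lemma charge_eq_AE: "AE x in lborel. charge x = f x"
  using AE_lborel_not_in_finite[OF finite_points] by eventually_elim (simp add: charge_def)

lemma integrable_charge_lborel: "integrable lborel charge"
  using integrable_f charge_eq_AE integrable_cong_AE[of charge lborel f] by simp

text \<open>Tests the charge against bounded functions: \<open>u = 1\<close> yields neutrality,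
  \<open>indicator A\<close> the signed measure of \<open>A\<close>, and
  \<open>indicator {x}\<close> the atoms.\<close>

lemma has_bochner_integral_charge_mult:
  assumes [measurable]: "u \<in> borel_measurable borel" and u: "\<And>x. \<bar>u x\<bar> \<le> 1"
  shows "has_bochner_integral base (\<lambda>x. u x * charge x) ((LINT x|lborel. u x * f x) - c * (\<Sum>q\<in>Q. u q))"
proof -
  have "integrable lborel (\<lambda>x. u x * charge x)"
  proof (rule Bochner_Integration.integrable_bound[OF integrable_charge_lborel])
    show "AE x in lborel. norm (u x * charge x) \<le> norm (charge x)"
      using u by (intro AE_I2) (simp add: abs_mult mult_left_le_one_le)
  qed measurable
  moreover have "(LINT x|lborel. u x * charge x) = (LINT x|lborel. u x * f x)"
    using charge_eq_AE by (intro integral_cong_AE) (auto elim!: eventually_mono)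
  moreover have "(\<Sum>q\<in>Q. u q * charge q) = - (c * (\<Sum>q\<in>Q. u q))"
    by (simp add: charge_def sum_distrib_left sum_negf mult.commute)
  ultimately show ?thesis
    using has_bochner_integral_point_charge_base[OF finite_points, of "\<lambda>x. u x * charge x"] by simp
qed

text \<open>The bound is finite at every \<open>y\<close>, also at the points: the summand
  \<open>q = y\<close> is 0 because \<open>ln 0 = 0\<close>.\<close>

lemma nn_integral_log_charge:
  "(\<integral>\<^sup>+x. ennreal (\<bar>charge x\<bar> * \<bar>ln (norm (x - y))\<bar>) \<partial>base)
    \<le> ennreal ((R + norm y + 1) * (LINT x|lborel. \<bar>f x\<bar>) + K * pi) + (\<Sum>q\<in>Q. ennreal (c * \<bar>ln (norm (y - q))\<bar>))"
proof -
  have "(\<integral>\<^sup>+x. ennreal (\<bar>charge x\<bar> * \<bar>ln (norm (x - y))\<bar>) \<partial>base)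
    = (\<integral>\<^sup>+x. ennreal (\<bar>charge x\<bar> * \<bar>ln (norm (x - y))\<bar>) \<partial>lborel) + (\<Sum>q\<in>Q. ennreal (\<bar>charge q\<bar> * \<bar>ln (norm (q - y))\<bar>))"
    by (intro nn_integral_point_charge_base finite_points) measurable
  also have "(\<integral>\<^sup>+x. ennreal (\<bar>charge x\<bar> * \<bar>ln (norm (x - y))\<bar>) \<partial>lborel) = (\<integral>\<^sup>+x. ennreal (\<bar>f x\<bar> * \<bar>ln (norm (x - y))\<bar>) \<partial>lborel)"
    using charge_eq_AE by (intro nn_integral_cong_AE) (auto elim!: eventually_mono)
  also have "(\<Sum>q\<in>Q. ennreal (\<bar>charge q\<bar> * \<bar>ln (norm (q - y))\<bar>)) = (\<Sum>q\<in>Q. ennreal (c * \<bar>ln (norm (y - q))\<bar>))"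
    using weight by (intro sum.cong) (auto simp: charge_def norm_minus_commute)
  finally show ?thesis
    using nn_integral_log_potential_le[OF integrable_f bounded_f support_f K R, of y] by (simp add: add_right_mono)
qed

text \<open>Background with background is finite because \<open>A\<close> is bounded on the support
  of \<open>f\<close>; background with points by the potential bound at each \<open>q\<close>;
  points with points as a finite sum.\<close>

lemma integrable_log_charge:
  "integrable (base \<Otimes>\<^sub>M base) (\<lambda>p. charge (fst p) * charge (snd p) * ln (norm (fst p - snd p)))"
proof (rule integrableI_bounded)
  interpret sigma_finite_measure base by (intro sigma_finite_point_charge_base finite_points)
  interpret pair_sigma_finite base base ..
  define I where "I = (LINT x|lborel. \<bar>f x\<bar>)"
  have I: "0 \<le> I" by (simp add: I_def)
  define A where "A y = ennreal ((R + norm y + 1) * I + K * pi)" for y :: R2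
  define S where "S y = (\<Sum>q\<in>Q. ennreal (c * \<bar>ln (norm (y - q))\<bar>))" for y
  have [measurable]: "A \<in> borel_measurable borel" "S \<in> borel_measurable borel"
    unfolding A_def S_def by measurable
  have [measurable]: "(\<lambda>p. charge (fst p) * charge (snd p) * ln (norm (fst p - snd p))) \<in> borel_measurable (base \<Otimes>\<^sub>M base)"
    by measurable
  show "(\<lambda>p. charge (fst p) * charge (snd p) * ln (norm (fst p - snd p))) \<in> borel_measurable (base \<Otimes>\<^sub>M base)"
    by measurable
  have "(\<integral>\<^sup>+p. ennreal (norm (charge (fst p) * charge (snd p) * ln (norm (fst p - snd p)))) \<partial>(base \<Otimes>\<^sub>M base))
    = (\<integral>\<^sup>+y. \<integral>\<^sup>+x. ennreal \<bar>charge y\<bar> * ennreal (\<bar>charge x\<bar> * \<bar>ln (norm (x - y))\<bar>) \<partial>base \<partial>base)"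
    by (subst nn_integral_snd[symmetric]) (auto simp: abs_mult ac_simps simp flip: ennreal_mult intro!: nn_integral_cong)
  also have "\<dots> = (\<integral>\<^sup>+y. ennreal \<bar>charge y\<bar> * (\<integral>\<^sup>+x. ennreal (\<bar>charge x\<bar> * \<bar>ln (norm (x - y))\<bar>) \<partial>base) \<partial>base)"
    by (intro nn_integral_cong nn_integral_cmult) measurable
  also have "\<dots> \<le> (\<integral>\<^sup>+y. ennreal \<bar>charge y\<bar> * (A y + S y) \<partial>base)"
    using nn_integral_log_charge unfolding A_def S_def I_def by (intro nn_integral_mono mult_left_mono) auto
  also have "\<dots> = (\<integral>\<^sup>+y. ennreal \<bar>charge y\<bar> * (A y + S y) \<partial>lborel) + (\<Sum>y\<in>Q. ennreal \<bar>charge y\<bar> * (A y + S y))"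
    by (intro nn_integral_point_charge_base finite_points) measurable
  also have "(\<integral>\<^sup>+y. ennreal \<bar>charge y\<bar> * (A y + S y) \<partial>lborel) = (\<integral>\<^sup>+y. ennreal \<bar>f y\<bar> * A y + ennreal \<bar>f y\<bar> * S y \<partial>lborel)"
    using charge_eq_AE by (intro nn_integral_cong_AE) (auto elim!: eventually_mono simp: distrib_left)
  also have "\<dots> = (\<integral>\<^sup>+y. ennreal \<bar>f y\<bar> * A y \<partial>lborel) + (\<integral>\<^sup>+y. ennreal \<bar>f y\<bar> * S y \<partial>lborel)"
    by (intro nn_integral_add) measurable
  also have "\<dots> + (\<Sum>y\<in>Q. ennreal \<bar>charge y\<bar> * (A y + S y)) < \<infinity>"
  proof -
    have "(\<integral>\<^sup>+y. ennreal \<bar>f y\<bar> * A y \<partial>lborel) \<le> (\<integral>\<^sup>+y. ennreal ((R + R + 1) * I + K * pi) * ennreal \<bar>f y\<bar> \<partial>lborel)"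
    proof (rule nn_integral_mono_AE)
      show "AE y in lborel. ennreal \<bar>f y\<bar> * A y \<le> ennreal ((R + R + 1) * I + K * pi) * ennreal \<bar>f y\<bar>"
        using support_f
      proof eventually_elim
        case (elim y)
        then show ?case
          using I by (cases "f y = 0") (auto simp: A_def mult.commute[of "ennreal \<bar>f y\<bar>"] intro!: mult_right_mono ennreal_leI)
      qed
    qed
    also have "\<dots> = ennreal ((R + R + 1) * I + K * pi) * ennreal I"
      using integrable_f by (simp add: nn_integral_cmult nn_integral_eq_integral I_def)
    finally have 1: "(\<integral>\<^sup>+y. ennreal \<bar>f y\<bar> * A y \<partial>lborel) < \<infinity>"
      by (simp add: ennreal_mult_less_top le_less_trans)
    have "(\<integral>\<^sup>+y. ennreal \<bar>f y\<bar> * S y \<partial>lborel) = (\<integral>\<^sup>+y. (\<Sum>q\<in>Q. ennreal c * ennreal (\<bar>f y\<bar> * \<bar>ln (norm (y - q))\<bar>)) \<partial>lborel)"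
      unfolding S_def using weight
      unfolding sum_distrib_left
      by (intro nn_integral_cong sum.cong refl) (simp add: mult.left_commute flip: ennreal_mult)
    also have "\<dots> = (\<Sum>q\<in>Q. ennreal c * (\<integral>\<^sup>+y. ennreal (\<bar>f y\<bar> * \<bar>ln (norm (y - q))\<bar>) \<partial>lborel))"
      by (subst nn_integral_sum) (auto simp: nn_integral_cmult)
    also have "\<dots> \<le> (\<Sum>q\<in>Q. ennreal c * A q)"
      unfolding A_def I_def
      by (intro sum_mono mult_left_mono nn_integral_log_potential_le integrable_f bounded_f support_f K R) simp
    also have "\<dots> < \<infinity>"
      using finite_points by (simp add: A_def ennreal_mult_less_top less_top)
    finally have 2: "(\<integral>\<^sup>+y. ennreal \<bar>f y\<bar> * S y \<partial>lborel) < \<infinity>" .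
    have 3: "(\<Sum>y\<in>Q. ennreal \<bar>charge y\<bar> * (A y + S y)) < \<infinity>"
      using finite_points by (simp add: A_def S_def ennreal_mult_less_top less_top)
    show ?thesis using 1 2 3 by simp
  qed
  finally show "(\<integral>\<^sup>+p. ennreal (norm (charge (fst p) * charge (snd p) * ln (norm (fst p - snd p)))) \<partial>(base \<Otimes>\<^sub>M base)) < \<infinity>" .
qed

sublocale neutral_charge base charge
proof (unfold neutral_charge_def neutral_charge_axioms_def, intro conjI)
  show "sigma_finite_measure base" by (intro sigma_finite_point_charge_base finite_points)
  have "has_bochner_integral base charge ((LINT x|lborel. f x) - c * card Q)"
    using has_bochner_integral_charge_mult[of "\<lambda>x. 1"] by simp
  then show "integrable base charge" "(LINT x|base. charge x) = 0"
    by (auto simp: has_bochner_integral_iff total_charge)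
qed (simp_all add: integrable_log_charge)

text \<open>For fixed \<open>x\<close> the diagonal slice is \<open>{x}\<close>, whose charge is
  \<open>- c\<close> at the points and 0 elsewhere, so the outer integrand lives on
  \<open>Q\<close>.\<close>

lemma self_mass_eq: "self_mass = c\<^sup>2 * card Q"
proof -
  have inner: "(LINT y|base. indicator diagonal (x, y) * (charge x * charge y)) = (if x \<in> Q then c\<^sup>2 else 0)" for x
  proof -
    have eq: "indicator diagonal (x, y) * (charge x * charge y) = indicator {x} y * charge y * charge x" for y
      by (auto simp: indicator_def diagonal_eq)
    have "(LINT y|base. indicator {x} y * charge y) = (LINT y|lborel. indicator {x} y * f y) - c * (\<Sum>q\<in>Q. indicator {x} q)"
      by (intro has_bochner_integral_integral_eq has_bochner_integral_charge_mult) (auto simp: indicator_def)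
    also have "(LINT y|lborel. indicator {x} y * f y) = (LINT y|(lborel :: R2 measure). 0)"
      using AE_lborel_singleton[of x] by (intro integral_cong_AE) (auto elim!: eventually_mono)
    also have "(\<Sum>q\<in>Q. indicator {x} q) = (indicator Q x :: real)"
      using finite_points by (simp add: indicator_def)
    finally show ?thesis
      unfolding eq by (simp add: charge_def indicator_def power2_eq_square)
  qed
  have "self_mass = (LINT x|base. LINT y|base. indicator diagonal (x, y) * (charge x * charge y))"
    unfolding self_mass_def using integral_fst[of "\<lambda>x y. indicator diagonal (x, y) * (charge x * charge y)"] integrable_diagonal
    by (simp add: case_prod_beta')
  also have "\<dots> = (\<Sum>q\<in>Q. if q \<in> Q then c\<^sup>2 else 0)"
    unfolding inner by (intro integral_point_charge_base_AE_0 finite_points) auto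
  finally show ?thesis by simp
qed

text \<open>On \<open>Q\<close> the charge is \<open>- c \<le> 0\<close>, so its positive part has
  no atoms, and an upper bound \<open>M\<close> for \<open>f\<close> meets the Gaussian mass
  \<open>pi / t\<close>.\<close>

lemma integral_gaussian_charge_le:
  assumes t: "0 < t" and M: "AE x in lborel. f x \<le> M" "0 \<le> M"
  shows "(LINT x|base. gaussian t x y * max 0 (charge x)) \<le> M * pi / t"
proof -
  have int: "integrable lborel (\<lambda>x. gaussian t x y * max 0 (charge x))"
    using integrable_charge_lborel t by (intro integrable_bounded_mult) (auto simp: mult_nonneg_nonneg)
  have "(LINT x|base. gaussian t x y * max 0 (charge x)) = (LINT x|lborel. gaussian t x y * max 0 (charge x))"
    using has_bochner_integral_integral_eq[OF has_bochner_integral_point_charge_base[OF finite_points int]] weight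
    by (simp add: charge_def)
  also have "\<dots> \<le> (LINT x|lborel. M * gaussian t x y)"
  proof (rule integral_mono_AE)
    show "AE x in lborel. gaussian t x y * max 0 (charge x) \<le> M * gaussian t x y"
      using M(1) charge_eq_AE by eventually_elim (use M(2) in \<open>simp add: mult.commute mult_right_mono\<close>)
  qed (use int has_bochner_integral_gaussian[OF t] in \<open>auto simp: has_bochner_integral_iff\<close>)
  also have "\<dots> = M * pi / t"
    using has_bochner_integral_integral_eq[OF has_bochner_integral_gaussian[OF t]] by simp
  finally show ?thesis .
qed

lemma integral_abs_charge: "(LINT x|base. \<bar>charge x\<bar>) = (LINT x|lborel. \<bar>f x\<bar>) + c * card Q"
proof -
  have "(LINT x|base. \<bar>charge x\<bar>) = (LINT x|lborel. \<bar>charge x\<bar>) + (\<Sum>q\<in>Q. \<bar>charge q\<bar>)"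
    using integrable_charge_lborel
    by (intro has_bochner_integral_integral_eq has_bochner_integral_point_charge_base finite_points) auto
  also have "(LINT x|lborel. \<bar>charge x\<bar>) = (LINT x|lborel. \<bar>f x\<bar>)"
    using charge_eq_AE by (intro integral_cong_AE) (auto elim!: eventually_mono)
  finally show ?thesis
    using weight by (simp add: charge_def mult.commute)
qed

end

section \<open>From the functional to the charge density, and the final estimates\<close>

lemma borel_measurable_g [measurable]: "g \<in> borel_measurable borel"
  unfolding g_def by measurable

text \<open>The sum norm serves as the bound since it is the quantity on which \<open>B\<close> may
  depend.\<close>

lemma L1_Linf_AE_bound:
  assumes "h \<in> L1_Linf"
  shows "AE x in lborel. \<bar>h x\<bar> \<le> enn2real (norm_L1_Linf h)"
proof -
  have fin: "norm_L1_Linf h < \<infinity>" using assms by (simp add: L1_Linf_def)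
  have "AE x in lborel. ennreal (norm (h x)) \<le> norm_Linf h"
    unfolding norm_Linf_def by (rule esssup_AE)
  then show ?thesis
  proof eventually_elim
    case (elim x)
    also have "norm_Linf h \<le> norm_L1_Linf h"
      by (simp add: norm_L1_Linf_def)
    finally show ?case
      using fin by (metis enn2real_ennreal enn2real_mono infinity_ennreal_def norm_ge_zero real_norm_def)
  qed
qed

lemma compactly_supported_AE:
  assumes "compactly_supported h"
  obtains R where "0 \<le> R" "AE x in lborel. h x \<noteq> 0 \<longrightarrow> norm x \<le> R"
proof -
  obtain A where A: "compact A" "AE x in lborel. x \<notin> A \<longrightarrow> h x = 0"
    using assms by (auto simp: compactly_supported_def)
  obtain R where R: "0 < R" "\<forall>x\<in>A. norm x \<le> R"
    using compact_imp_bounded[OF A(1)] by (auto simp: bounded_pos)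
  then have "AE x in lborel. h x \<noteq> 0 \<longrightarrow> norm x \<le> R"
    using A(2) by (auto elim!: eventually_mono)
  with R(1) show ?thesis by (intro that) auto
qed

text \<open>Relative to \<open>base\<close> the whole of \<open>\<sigma>\<close>, points included,
  has the density \<open>charge\<close>; this is what makes
  \<open>signed_set_integral_signed_product\<close> applicable.\<close>

lemma (in charged_points) signed_energy_eq:
  assumes "\<And>A. A \<in> sets borel \<Longrightarrow> \<sigma> A = of_density f A - c * (\<Sum>q\<in>Q. indicator A q)"
  shows "signed_set_integral (borel \<Otimes>\<^sub>M borel) (signed_product borel \<sigma> borel \<sigma>) (UNIV - diagonal) (\<lambda>(x, y). g (x - y))
    = (LINT p|(base \<Otimes>\<^sub>M base). charge (fst p) * charge (snd p) * g (fst p - snd p))"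
proof -
  \<comment> \<open>the diagonal may be ignored because \<open>ln 0 = 0\<close> gives \<open>g 0 = 0\<close>\<close>
  have off: "indicator (UNIV - diagonal) p * (charge (fst p) * charge (snd p) * (case p of (x, y) \<Rightarrow> g (x - y)))
    = charge (fst p) * charge (snd p) * g (fst p - snd p)" for p
    by (auto simp: indicator_def diagonal_eq g_def split: prod.split)
  have g: "charge (fst p) * charge (snd p) * g (fst p - snd p)
    = - (1 / (2 * pi)) * (charge (fst p) * charge (snd p) * ln (norm (fst p - snd p)))" for p
    by (simp add: g_def)
  have "integrable (base \<Otimes>\<^sub>M base) (\<lambda>p. charge (fst p) * charge (snd p) * g (fst p - snd p))"
    unfolding g by (intro integrable_mult_right integrable_log)
  moreover have "\<sigma> A = (LINT x:A|base. charge x)" if A: "A \<in> sets borel" for A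
  proof -
    have "(LINT x|base. indicator A x * charge x) = (LINT x|lborel. indicator A x * f x) - c * (\<Sum>q\<in>Q. indicator A q)"
      using A by (intro has_bochner_integral_integral_eq has_bochner_integral_charge_mult) (auto simp: indicator_def)
    then show ?thesis
      using assms[OF A] by (simp add: of_density_def set_lebesgue_integral_def)
  qed
  moreover have "UNIV - diagonal \<in> sets (borel \<Otimes>\<^sub>M borel)"
    using sets.compl_sets[OF sets_diagonal] by (simp add: space_pair_measure)
  moreover have "(\<lambda>(x, y). g (x - y)) \<in> borel_measurable (borel \<Otimes>\<^sub>M borel)"
    by measurable
  ultimately show ?thesis
    using signed_set_integral_signed_product[OF sigma_finite_point_charge_base[OF finite_points] integrable_charge sets_point_charge_base,
        of "UNIV - diagonal" "\<lambda>(x, y). g (x - y)" \<sigma>]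
    unfolding off by blast
qed

text \<open>The case without points: the base is Lebesgue measure and \<open>self_mass\<close> is
  0.\<close>

lemma logarithmic_energy_nonneg:
  assumes "integrable lborel h" "AE x in lborel. \<bar>h x\<bar> \<le> K" "0 \<le> K"
    "AE x in lborel. h x \<noteq> 0 \<longrightarrow> norm x \<le> R" "0 \<le> R" "(LINT x|lborel. h x) = 0"
  shows "0 \<le> (LINT (x, y)|(lborel \<Otimes>\<^sub>M lborel). g (x - y) * h x * h y)"
proof -
  interpret charged_points "{}" h 0 K R
    by standard (use assms in simp_all)
  have "charge = h" by (simp add: charge_def fun_eq_iff)
  moreover have "0 \<le> (LINT p|(base \<Otimes>\<^sub>M base). charge (fst p) * charge (snd p) * g (fst p - snd p))"
    by (rule energy_nonneg) (simp add: self_mass_eq)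
  ultimately show ?thesis
    by (simp add: point_charge_base_empty case_prod_beta' mult_ac)
qed

text \<open>The bound of \<open>energy_ge\<close> for \<open>D = 1 / N\<close> and
  \<open>C = 8 * M * pi\<close>, with \<open>N powr (- \<gamma>)\<close> factored out after
  estimating \<open>1 / N\<close> by it.\<close>

definition energy_constant :: "real \<Rightarrow> real \<Rightarrow> real" where
  "energy_constant \<gamma> M = 1 / (4 * pi) * (1 + (8 * M * pi) powr (1 - \<gamma>) / (1 - \<gamma>))"

lemma modulated_energy_ge:
  fixes \<gamma> :: real
  assumes \<gamma>: "0 < \<gamma>" "\<gamma> < 1" and N: "1 \<le> N"
    and \<rho>: "\<rho> \<in> L1_Linf" "probability_density \<rho>" "compactly_supported \<rho>"
    and \<omega>: "\<omega> \<in> L1_Linf" "probability_density \<omega>" "compactly_supported \<omega>"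
    and \<omega>N: "\<omega>N \<in> L1_Linf" "probability_density \<omega>N" "compactly_supported \<omega>N"
    and Q: "inj_on Q {1..N}"
  shows "- (energy_constant \<gamma> (enn2real (norm_L1_Linf \<omega>) + enn2real (norm_L1_Linf \<rho>)) * real N powr (- \<gamma>))
    \<le> modulated_energy \<omega> \<rho> \<omega>N N Q"
proof -
  define f where "f x = \<rho> x + \<omega> x - \<omega>N x" for x
  \<comment> \<open>\<open>M\<close> bounds \<open>f\<close> from above: \<open>\<omega>N\<close> is
    nonnegative and is subtracted. \<open>K\<close> bounds \<open>\<bar>f x\<bar>\<close> and serves
    the integrability of the logarithm.\<close>
  define M where "M = enn2real (norm_L1_Linf \<omega>) + enn2real (norm_L1_Linf \<rho>)"
  define K where "K = M + enn2real (norm_L1_Linf \<omega>N)"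
  obtain R1 where R1: "0 \<le> R1" "AE x in lborel. \<rho> x \<noteq> 0 \<longrightarrow> norm x \<le> R1"
    using compactly_supported_AE[OF \<rho>(3)] .
  obtain R2 where R2: "0 \<le> R2" "AE x in lborel. \<omega> x \<noteq> 0 \<longrightarrow> norm x \<le> R2"
    using compactly_supported_AE[OF \<omega>(3)] .
  obtain R3 where R3: "0 \<le> R3" "AE x in lborel. \<omega>N x \<noteq> 0 \<longrightarrow> norm x \<le> R3"
    using compactly_supported_AE[OF \<omega>N(3)] .
  note R = R1 R2 R3
  have int: "integrable lborel \<rho>" "integrable lborel \<omega>" "integrable lborel \<omega>N"
    and mass: "(LINT x|lborel. \<rho> x) = 1" "(LINT x|lborel. \<omega> x) = 1" "(LINT x|lborel. \<omega>N x) = 1"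
    and nonneg: "AE x in lborel. 0 \<le> \<rho> x" "AE x in lborel. 0 \<le> \<omega> x" "AE x in lborel. 0 \<le> \<omega>N x"
    using \<rho>(2) \<omega>(2) \<omega>N(2) by (auto simp: probability_density_def)
  note bounds = L1_Linf_AE_bound[OF \<rho>(1)] L1_Linf_AE_bound[OF \<omega>(1)] L1_Linf_AE_bound[OF \<omega>N(1)]
  have M: "0 \<le> M" by (simp add: M_def)
  have card: "card (Q ` {1..N}) = N" using Q by (simp add: card_image)
  interpret charged_points "Q ` {1..N}" f "1 / real N" K "R1 + R2 + R3"
  proof
    show "integrable lborel f" unfolding f_def using int by simp
    show "AE x in lborel. \<bar>f x\<bar> \<le> K"
      using bounds by eventually_elim (simp add: f_def K_def M_def)
    show "AE x in lborel. f x \<noteq> 0 \<longrightarrow> norm x \<le> R1 + R2 + R3"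
      using R(2) R(4) R(6) by eventually_elim (use R in \<open>fastforce simp: f_def\<close>)
    \<comment> \<open>The masses \<open>1 + 1 - 1\<close> balance \<open>N\<close> points of weight
      \<open>1 / N\<close>.\<close>
    show "(LINT x|lborel. f x) = 1 / real N * real (card (Q ` {1..N}))"
      unfolding f_def card using int mass N by simp
  qed (use R in \<open>simp_all add: K_def M_def\<close>)
  have energy: "modulated_energy \<omega> \<rho> \<omega>N N Q
    = (LINT p|(base \<Otimes>\<^sub>M base). charge (fst p) * charge (snd p) * g (fst p - snd p))"
    unfolding modulated_energy_def Let_def
  proof (rule signed_energy_eq)
    fix A :: "R2 set" assume "A \<in> sets borel"
    then have "integrable lborel (\<lambda>x. indicator A x * u x)" if "integrable lborel u" for u :: "R2 \<Rightarrow> real"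
      using integrable_mult_indicator[of A lborel u] that by simp
    then have "of_density f A = of_density \<rho> A + of_density \<omega> A - of_density \<omega>N A"
      using int by (simp add: of_density_def set_lebesgue_integral_def f_def algebra_simps)
    \<comment> \<open>Distinctness makes the sum over indices a sum over the set of points.\<close>
    moreover have "empirical N Q A = 1 / real N * (\<Sum>q\<in>Q ` {1..N}. indicator A q)"
      using Q by (simp add: empirical_def dirac_def sum.reindex)
    ultimately show "of_density \<rho> A + of_density \<omega> A - empirical N Q A - of_density \<omega>N A
      = of_density f A - 1 / real N * (\<Sum>q\<in>Q ` {1..N}. indicator A q)"
      by simp
  qed
  \<comment> \<open>The three densities contribute at most 3 to the total variation, the points
    1.\<close>
  have mass_charge: "(LINT x|base. \<bar>charge x\<bar>) \<le> 4"
  proof -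
    have "(LINT x|lborel. \<bar>f x\<bar>) \<le> (LINT x|lborel. \<rho> x + \<omega> x + \<omega>N x)"
    proof (rule integral_mono_AE)
      show "AE x in lborel. \<bar>f x\<bar> \<le> \<rho> x + \<omega> x + \<omega>N x"
        using nonneg by eventually_elim (simp add: f_def)
    qed (use int integrable_f in auto)
    also have "\<dots> = 3" using int mass by simp
    finally show ?thesis unfolding integral_abs_charge card using N by simp
  qed
  have self: "0 \<le> self_mass" unfolding self_mass_eq by simp
  have f_le: "AE x in lborel. f x \<le> M"
    using bounds nonneg by eventually_elim (simp add: f_def M_def)
  have "- (1 / (4 * pi) * (1 / real N + (1 / real N) powr \<gamma> * (8 * M * pi) powr (1 - \<gamma>) / (1 - \<gamma>)))
      \<le> (LINT p|(base \<Otimes>\<^sub>M base). charge (fst p) * charge (snd p) * g (fst p - snd p))"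
  proof (rule energy_ge)
    show "self_mass \<le> 1 / real N"
      unfolding self_mass_eq card using N by (simp add: power2_eq_square)
    fix t :: real assume "1 \<le> t"
    then have t: "0 < t" by simp
    have "- (2 * M * pi * (LINT x|base. \<bar>charge x\<bar>) / t) \<le> \<Phi> t"
      using t by (intro \<Phi>_ge_inverse integral_gaussian_charge_le f_le M self)
    \<comment> \<open>The 4 from \<open>mass_charge\<close> and the 2 from
      \<open>\<Phi>_ge_inverse\<close> make the constant 8.\<close>
    moreover have "2 * M * pi * (LINT x|base. \<bar>charge x\<bar>) / t \<le> 2 * M * pi * 4 / t"
      using t M mass_charge by (intro divide_right_mono mult_left_mono) auto
    ultimately show "- (8 * M * pi / t) \<le> \<Phi> t" by simp
  qed (use \<gamma> M in auto)
  moreover have "1 / (4 * pi) * (1 / real N + (1 / real N) powr \<gamma> * (8 * M * pi) powr (1 - \<gamma>) / (1 - \<gamma>))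
    \<le> energy_constant \<gamma> M * real N powr (- \<gamma>)"
  proof -
    have "1 / real N = real N powr (- 1)" using N by (simp add: powr_minus_divide)
    also have "\<dots> \<le> real N powr (- \<gamma>)" using N \<gamma> by (intro powr_mono) auto
    finally have 1: "1 / real N \<le> real N powr (- \<gamma>)" .
    have 2: "(1 / real N) powr \<gamma> = real N powr (- \<gamma>)"
      using N by (simp add: powr_divide powr_minus_divide)
    have "1 / (4 * pi) * (1 / real N + (1 / real N) powr \<gamma> * (8 * M * pi) powr (1 - \<gamma>) / (1 - \<gamma>))
      \<le> 1 / (4 * pi) * (real N powr (- \<gamma>) + real N powr (- \<gamma>) * (8 * M * pi) powr (1 - \<gamma>) / (1 - \<gamma>))"
      unfolding 2 by (intro mult_left_mono add_right_mono 1) simp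
    also have "\<dots> = energy_constant \<gamma> M * real N powr (- \<gamma>)"
      by (simp add: energy_constant_def algebra_simps)
    finally show ?thesis .
  qed
  ultimately show ?thesis
    unfolding energy M_def by linarith
qed

theorem proposition1p8:
  shows "\<exists>B :: real \<Rightarrow> ennreal \<Rightarrow> ennreal \<Rightarrow> ennreal \<Rightarrow> real.
    \<forall>(\<gamma> :: real) (\<rho> :: R2 \<Rightarrow> real) (\<omega> :: R2 \<Rightarrow> real) (\<omega>s :: nat \<Rightarrow> R2 \<Rightarrow> real).
      0 < \<gamma> \<and> \<gamma> < 1 \<and>
      \<rho> \<in> L1_Linf \<and> probability_density \<rho> \<and> compactly_supported \<rho> \<and>
      \<omega> \<in> L1_Linf \<and> probability_density \<omega> \<and> compactly_supported \<omega> \<and>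
      (\<forall>N\<ge>1. \<omega>s N \<in> L1_Linf \<and> probability_density (\<omega>s N) \<and> compactly_supported (\<omega>s N)) \<and>
      (SUP N\<in>{1..}. norm_L1_Linf (\<omega>s N)) < \<infinity> \<longrightarrow>
      (let b = B \<gamma> (norm_L1_Linf \<omega>) (norm_L1_Linf \<rho>) (SUP N\<in>{1..}. norm_L1_Linf (\<omega>s N)) in
       \<forall>N\<ge>1. \<forall>v\<in>W1inf. \<forall>(P :: nat \<Rightarrow> R2) (Q :: nat \<Rightarrow> R2).
         (\<forall>i\<in>{1..N}. \<forall>j\<in>{1..N}. i \<noteq> j \<longrightarrow> Q i \<noteq> Q j) \<longrightarrow>
           modulated_energy \<omega> \<rho> (\<omega>s N) N Q + b * real N powr (- \<gamma>) \<ge> 0 \<and>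
           \<H> b \<gamma> \<omega> \<rho> v (\<omega>s N) N Q P \<ge> 0)"
proof (intro exI[of _ "\<lambda>\<gamma> w r u. energy_constant \<gamma> (enn2real w + enn2real r)"] allI impI, elim conjE, unfold Let_def, intro allI ballI impI)
  fix \<gamma> :: real and \<rho> \<omega> :: "R2 \<Rightarrow> real" and \<omega>s :: "nat \<Rightarrow> R2 \<Rightarrow> real" and N :: nat
    and v :: "R2 \<Rightarrow> R2" and P Q :: "nat \<Rightarrow> R2"
  assume \<gamma>: "0 < \<gamma>" "\<gamma> < 1" and N: "1 \<le> N"
    and \<rho>: "\<rho> \<in> L1_Linf" "probability_density \<rho>" "compactly_supported \<rho>"
    and \<omega>: "\<omega> \<in> L1_Linf" "probability_density \<omega>" "compactly_supported \<omega>"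
    and \<omega>s: "\<forall>N\<ge>1. \<omega>s N \<in> L1_Linf \<and> probability_density (\<omega>s N) \<and> compactly_supported (\<omega>s N)"
    and Q: "\<forall>i\<in>{1..N}. \<forall>j\<in>{1..N}. i \<noteq> j \<longrightarrow> Q i \<noteq> Q j"
  \<comment> \<open>Both norms are finite by membership in \<open>L1_Linf\<close>, so
    \<open>enn2real\<close> keeps their values.\<close>
  let ?b = "energy_constant \<gamma> (enn2real (norm_L1_Linf \<omega>) + enn2real (norm_L1_Linf \<rho>))"
  have \<omega>N: "\<omega>s N \<in> L1_Linf" "probability_density (\<omega>s N)" "compactly_supported (\<omega>s N)"
    using \<omega>s N by auto
  have "inj_on Q {1..N}" using Q by (auto simp: inj_on_def)
  from modulated_energy_ge[OF \<gamma> N \<rho> \<omega> \<omega>N this]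
  have energy: "0 \<le> modulated_energy \<omega> \<rho> (\<omega>s N) N Q + ?b * real N powr (- \<gamma>)"
    by simp
  obtain R1 where R1: "0 \<le> R1" "AE x in lborel. \<omega> x \<noteq> 0 \<longrightarrow> norm x \<le> R1"
    using compactly_supported_AE[OF \<omega>(3)] .
  obtain R2 where R2: "0 \<le> R2" "AE x in lborel. \<omega>s N x \<noteq> 0 \<longrightarrow> norm x \<le> R2"
    using compactly_supported_AE[OF \<omega>N(3)] .
  note R = R1 R2
  have "0 \<le> (LINT (x, y)|(lborel \<Otimes>\<^sub>M lborel). g (x - y) * (\<omega> x - \<omega>s N x) * (\<omega> y - \<omega>s N y))"
  proof (rule logarithmic_energy_nonneg)
    show "AE x in lborel. \<bar>\<omega> x - \<omega>s N x\<bar> \<le> enn2real (norm_L1_Linf \<omega>) + enn2real (norm_L1_Linf (\<omega>s N))"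
      using L1_Linf_AE_bound[OF \<omega>(1)] L1_Linf_AE_bound[OF \<omega>N(1)] by eventually_elim simp
    show "AE x in lborel. \<omega> x - \<omega>s N x \<noteq> 0 \<longrightarrow> norm x \<le> R1 + R2"
      using R(2) R(4) by eventually_elim (use R in fastforce)
  qed (use \<omega>(2) \<omega>N(2) R in \<open>auto simp: probability_density_def\<close>)
  moreover have "0 \<le> 1 / real N * (\<Sum>i=1..N. (norm (v (Q i) - P i))\<^sup>2)"
    by (simp add: sum_nonneg)
  moreover have "0 \<le> (norm_L2 (\<lambda>x. \<omega> x - \<omega>s N x))\<^sup>2"
    by simp
  ultimately have "0 \<le> \<H> ?b \<gamma> \<omega> \<rho> v (\<omega>s N) N Q P"
    using energy unfolding \<H>_def by linarith
  with energy show "0 \<le> modulated_energy \<omega> \<rho> (\<omega>s N) N Q + ?b * real N powr (- \<gamma>) \<and> 0 \<le> \<H> ?b \<gamma> \<omega> \<rho> v (\<omega>s N) N Q P"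
    by blast
qed

end
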